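(* Let $\Omega$ be a bounded domain with piecewise smooth boundary $\partial\Omega$ and outward unit normal $\mathbf{n}$, let $\epsilon > 0$, and let $d \in L^2(\partial\Omega)$. For $\alpha > 0$ let $(f_\alpha^*, u_\alpha^* )$ be the solution of $$\min_{(f,u) \in L^2(\Omega) \times H^1(\Omega)} \left\{ \frac{1}{2}\|u - d\|_{L^2(\partial\Omega)}^2 + \frac{1}{2}\alpha \|f\|_{L^2(\Omega)}^2 \right\}$$ subject to $u$ being the weak solution of $$-\Delta u + \epsilon u = f \ \text{ in } \Omega, \qquad \frac{\partial u}{\partial \mathbf{n}} = 0 \ \text{ on } \partial\Omega.$$ Assume that the limit $f^* = \lim_{\alpha \to 0} f_\alpha^* = \mathsf{K}^\dagger d$ is a $C^2$-function, i.e., $f^* \in C^2(\overline{\Omega})$. Then $$-\Delta f^* + \epsilon f^* = 0 \quad \text{in } \Omega,$$ and consequently $f^*$ cannot attain a non-negative maximum in the interior of $\Omega$.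
   Context: The forward operator $\mathsf{K}: L^2(\Omega) \to L^2(\partial\Omega)$ is defined by $\mathsf{K} f = u|_{\partial\Omega}$ (the trace), where $u \in H^1(\Omega)$ is the unique weak solution of $-\Delta u + \epsilon u = f$ in $\Omega$, $\partial u/\partial\mathbf{n} = 0$ on $\partial\Omega$. $\mathsf{K}^\dagger$ denotes the Moore-Penrose inverse of $\mathsf{K}$, so $\mathsf{K}^\dagger d$ is the minimum $L^2(\Omega)$-norm least-squares solution of $\mathsf{K} f = d$.
   Formalization: The claim that f* cannot attain a non-negative maximum in the interior is stated only for f* not identically zero in Ω, since for d = 0 one has f* = 0, which attains the non-negative maximum 0 at every interior point. *)

theory Defs
  imports "HOL-Analysis.Analysis"
begin

section \<open>Classical differentiability\<close>

definition partial_deriv :: "'a \<Rightarrow> ('a::euclidean_space \<Rightarrow> real) \<Rightarrow> 'a \<Rightarrow> real" where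
  "partial_deriv i f x = frechet_derivative f (at x) i"

definition gradient :: "('a::euclidean_space \<Rightarrow> real) \<Rightarrow> 'a \<Rightarrow> 'a" where
  "gradient f x = (\<Sum>i\<in>Basis. partial_deriv i f x *\<^sub>R i)"

definition laplacian :: "('a::euclidean_space \<Rightarrow> real) \<Rightarrow> 'a \<Rightarrow> real" where
  "laplacian f x = (\<Sum>i\<in>Basis. partial_deriv i (partial_deriv i f) x)"

text \<open>\<open>Ck_on k S f\<close> is meant for open \<open>S\<close> only.\<close>

fun Ck_on :: "nat \<Rightarrow> 'a::euclidean_space set \<Rightarrow> ('a \<Rightarrow> real) \<Rightarrow> bool" where
  "Ck_on 0 S f \<longleftrightarrow> continuous_on S f"
| "Ck_on (Suc k) S f \<longleftrightarrow>
     (\<forall>x\<in>S. f differentiable (at x)) \<and> (\<forall>i\<in>Basis. Ck_on k S (partial_deriv i f))"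

definition smooth_on :: "'a::euclidean_space set \<Rightarrow> ('a \<Rightarrow> real) \<Rightarrow> bool" where
  "smooth_on S f \<longleftrightarrow> (\<forall>k. Ck_on k S f)"

text \<open>\<open>C\<^sup>k\<close> up to the boundary of the open set \<open>\<Omega>\<close>: \<open>f\<close> and all its partial derivatives in \<open>\<Omega>\<close>
  up to order \<open>k\<close> have continuous extensions to \<open>closure \<Omega>\<close>; in \<open>Ck_closure\<close> the extension of \<open>f\<close>
  itself is the restriction of \<open>f\<close> to \<open>closure \<Omega>\<close>.\<close>

fun Ck_extends :: "nat \<Rightarrow> 'a::euclidean_space set \<Rightarrow> ('a \<Rightarrow> real) \<Rightarrow> bool" where
  "Ck_extends 0 \<Omega> f \<longleftrightarrow> (\<exists>g. continuous_on (closure \<Omega>) g \<and> (\<forall>x\<in>\<Omega>. g x = f x))"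
| "Ck_extends (Suc k) \<Omega> f \<longleftrightarrow>
     (\<exists>g. continuous_on (closure \<Omega>) g \<and> (\<forall>x\<in>\<Omega>. g x = f x)) \<and>
     (\<forall>x\<in>\<Omega>. f differentiable (at x)) \<and> (\<forall>i\<in>Basis. Ck_extends k \<Omega> (partial_deriv i f))"

definition Ck_closure :: "nat \<Rightarrow> 'a::euclidean_space set \<Rightarrow> ('a \<Rightarrow> real) \<Rightarrow> bool" where
  "Ck_closure k \<Omega> f \<longleftrightarrow> continuous_on (closure \<Omega>) f \<and> Ck_extends k \<Omega> f"

definition test_function :: "'a::euclidean_space set \<Rightarrow> ('a \<Rightarrow> real) \<Rightarrow> bool" where
  "test_function \<Omega> \<phi> \<longleftrightarrow>
     smooth_on UNIV \<phi> \<and> compact (closure {x. \<phi> x \<noteq> 0}) \<and> closure {x. \<phi> x \<noteq> 0} \<subseteq> \<Omega>"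

section \<open>Surface measure\<close>

text \<open>The \<open>s\<close>-dimensional Hausdorff outer measure, normalised so that it agrees with Lebesgue measure
  on \<open>s\<close>-dimensional subspaces. The library's \<open>diameter\<close> is only meaningful for bounded sets. The empty
  set is treated separately because \<open>0 ^ 0 = 1\<close>, which for \<open>s = 0\<close> gives the counting measure.\<close>

definition hausdorff_gauge :: "nat \<Rightarrow> 'a::euclidean_space set \<Rightarrow> ennreal" where
  "hausdorff_gauge s C =
     (if C = {} then 0 else ennreal (unit_ball_vol (real s) * (diameter C / 2) ^ s))"

definition hausdorff_outer :: "nat \<Rightarrow> 'a::euclidean_space set \<Rightarrow> ennreal" where
  "hausdorff_outer s A =
     (SUP \<delta>\<in>{0<..}. INF C\<in>{C :: nat \<Rightarrow> 'a set. A \<subseteq> (\<Union>n. C n) \<and>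
         (\<forall>n. bounded (C n) \<and> diameter (C n) \<le> \<delta>)}. \<Sum>n. hausdorff_gauge s (C n))"

text \<open>This is a metric outer measure, hence countably additive on the Borel sets (Caratheodory), so
  \<open>measure_of\<close> does not degenerate here.\<close>

definition hausdorff_measure :: "nat \<Rightarrow> 'a::euclidean_space measure" where
  "hausdorff_measure s = measure_of UNIV (sets borel) (hausdorff_outer s)"

definition surface_measure :: "'a::euclidean_space set \<Rightarrow> 'a measure" where
  "surface_measure \<Omega> = restrict_space (hausdorff_measure (DIM('a) - 1)) (frontier \<Omega>)"

section \<open>Domains with piecewise smooth boundary\<close>

text \<open>Near \<open>x\<close> the boundary is a smooth hypersurface and \<open>\<Omega>\<close> lies on one side of it.\<close>

definition smooth_boundary_at :: "'a::euclidean_space set \<Rightarrow> 'a \<Rightarrow> bool" where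
  "smooth_boundary_at \<Omega> x \<longleftrightarrow>
     (\<exists>U \<psi>. open U \<and> x \<in> U \<and> smooth_on U \<psi> \<and> (\<forall>y\<in>U. gradient \<psi> y \<noteq> 0) \<and>
        \<Omega> \<inter> U = {y\<in>U. \<psi> y < 0})"

text \<open>The boundary has finite area and consists of finitely many smooth pieces, up to a set of zero
  area (edges, corners, vertices). No condition is put on how the pieces meet.\<close>

definition piecewise_smooth_boundary :: "'a::euclidean_space set \<Rightarrow> bool" where
  "piecewise_smooth_boundary \<Omega> \<longleftrightarrow>
     hausdorff_outer (DIM('a) - 1) (frontier \<Omega>) < \<infinity> \<and>
     (\<exists>\<M>. finite \<M> \<and>
        (\<forall>M\<in>\<M>. openin (top_of_set (frontier \<Omega>)) M \<and> connected M \<and> (\<forall>x\<in>M. smooth_boundary_at \<Omega> x)) \<and>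
        hausdorff_outer (DIM('a) - 1) (frontier \<Omega> - \<Union>\<M>) = 0)"

definition bounded_pw_smooth_domain :: "'a::euclidean_space set \<Rightarrow> bool" where
  "bounded_pw_smooth_domain \<Omega> \<longleftrightarrow>
     open \<Omega> \<and> connected \<Omega> \<and> \<Omega> \<noteq> {} \<and> bounded \<Omega> \<and> piecewise_smooth_boundary \<Omega>"

section \<open>\<open>L\<^sup>2\<close> and \<open>H\<^sup>1\<close>\<close>

text \<open>Elements of \<open>L\<^sup>2\<close> are represented by functions; the notions of this and the next section
  respect almost-everywhere equality.\<close>

definition L2 :: "'a measure \<Rightarrow> ('a \<Rightarrow> 'b::euclidean_space) set" where
  "L2 M = {f. f \<in> borel_measurable M \<and> integrable M (\<lambda>x. (norm (f x))\<^sup>2)}"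

definition L2_norm :: "'a measure \<Rightarrow> ('a \<Rightarrow> 'b::euclidean_space) \<Rightarrow> real" where
  "L2_norm M f = sqrt (\<integral>x. (norm (f x))\<^sup>2 \<partial>M)"

definition L2_tendsto ::
  "'a measure \<Rightarrow> ('i \<Rightarrow> 'a \<Rightarrow> 'b::euclidean_space) \<Rightarrow> ('a \<Rightarrow> 'b) \<Rightarrow> 'i filter \<Rightarrow> bool" where
  "L2_tendsto M f g F \<longleftrightarrow>
     (\<forall>\<^sub>F k in F. (\<lambda>x. f k x - g x) \<in> L2 M) \<and> ((\<lambda>k. L2_norm M (\<lambda>x. f k x - g x)) \<longlongrightarrow> 0) F"

text \<open>\<open>H1_grad \<Omega> u Du\<close>: \<open>u \<in> H\<^sup>1(\<Omega>)\<close> with weak gradient \<open>Du\<close>.\<close>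

definition H1_grad :: "'a::euclidean_space set \<Rightarrow> ('a \<Rightarrow> real) \<Rightarrow> ('a \<Rightarrow> 'a) \<Rightarrow> bool" where
  "H1_grad \<Omega> u Du \<longleftrightarrow>
     u \<in> L2 (lebesgue_on \<Omega>) \<and> Du \<in> L2 (lebesgue_on \<Omega>) \<and>
     (\<forall>\<phi>. test_function \<Omega> \<phi> \<longrightarrow> (\<forall>i\<in>Basis.
        (\<integral>x. u x * partial_deriv i \<phi> x \<partial>lebesgue_on \<Omega>) = - (\<integral>x. (Du x \<bullet> i) * \<phi> x \<partial>lebesgue_on \<Omega>)))"

text \<open>\<open>has_trace \<Omega> u g\<close>: \<open>u \<in> H\<^sup>1(\<Omega>)\<close> and \<open>u|\<^bsub>\<partial>\<Omega>\<^esub> = g\<close> in \<open>L\<^sup>2(\<partial>\<Omega>)\<close>, where the trace operator is the closure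
  of the restriction map on functions smooth up to the boundary.\<close>

definition has_trace :: "'a::euclidean_space set \<Rightarrow> ('a \<Rightarrow> real) \<Rightarrow> ('a \<Rightarrow> real) \<Rightarrow> bool" where
  "has_trace \<Omega> u g \<longleftrightarrow>
     g \<in> L2 (surface_measure \<Omega>) \<and>
     (\<exists>Du w. H1_grad \<Omega> u Du \<and> (\<forall>k. smooth_on UNIV (w k)) \<and>
        L2_tendsto (lebesgue_on \<Omega>) w u sequentially \<and>
        L2_tendsto (lebesgue_on \<Omega>) (\<lambda>k. gradient (w k)) Du sequentially \<and>
        L2_tendsto (surface_measure \<Omega>) w g sequentially)"

section \<open>The Neumann problem, the forward operator and the regularised problem\<close>

text \<open>Weak solutions of \<open>- \<Delta> u + \<epsilon> u = f\<close> in \<open>\<Omega>\<close>, \<open>\<partial>u/\<partial>n = 0\<close> on \<open>\<partial>\<Omega>\<close>; the Neumann condition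
  is the natural boundary condition of the variational formulation.\<close>

definition neumann_weak_solution ::
  "'a::euclidean_space set \<Rightarrow> real \<Rightarrow> ('a \<Rightarrow> real) \<Rightarrow> ('a \<Rightarrow> real) \<Rightarrow> bool" where
  "neumann_weak_solution \<Omega> \<epsilon> f u \<longleftrightarrow>
     (\<exists>Du. H1_grad \<Omega> u Du \<and>
       (\<forall>v Dv. H1_grad \<Omega> v Dv \<longrightarrow>
          (\<integral>x. Du x \<bullet> Dv x \<partial>lebesgue_on \<Omega>) + \<epsilon> * (\<integral>x. u x * v x \<partial>lebesgue_on \<Omega>)
            = (\<integral>x. f x * v x \<partial>lebesgue_on \<Omega>)))"

text \<open>\<open>forward_op \<Omega> \<epsilon> f g\<close>: \<open>K f = g\<close>, as the graph of \<open>K : L\<^sup>2(\<Omega>) \<rightarrow> L\<^sup>2(\<partial>\<Omega>)\<close>.\<close>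

definition forward_op ::
  "'a::euclidean_space set \<Rightarrow> real \<Rightarrow> ('a \<Rightarrow> real) \<Rightarrow> ('a \<Rightarrow> real) \<Rightarrow> bool" where
  "forward_op \<Omega> \<epsilon> f g \<longleftrightarrow>
     f \<in> L2 (lebesgue_on \<Omega>) \<and> (\<exists>u. neumann_weak_solution \<Omega> \<epsilon> f u \<and> has_trace \<Omega> u g)"

definition least_squares_solution ::
  "'a::euclidean_space set \<Rightarrow> real \<Rightarrow> ('a \<Rightarrow> real) \<Rightarrow> ('a \<Rightarrow> real) \<Rightarrow> bool" where
  "least_squares_solution \<Omega> \<epsilon> d f \<longleftrightarrow>
     (\<exists>g. forward_op \<Omega> \<epsilon> f g \<and>
       (\<forall>f' g'. forward_op \<Omega> \<epsilon> f' g' \<longrightarrow>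
          L2_norm (surface_measure \<Omega>) (\<lambda>x. g x - d x) \<le> L2_norm (surface_measure \<Omega>) (\<lambda>x. g' x - d x)))"

text \<open>\<open>moore_penrose_solution \<Omega> \<epsilon> d f\<close>: \<open>d\<close> lies in the domain of \<open>K\<^sup>\<dagger>\<close> and \<open>K\<^sup>\<dagger> d = f\<close>.\<close>

definition moore_penrose_solution ::
  "'a::euclidean_space set \<Rightarrow> real \<Rightarrow> ('a \<Rightarrow> real) \<Rightarrow> ('a \<Rightarrow> real) \<Rightarrow> bool" where
  "moore_penrose_solution \<Omega> \<epsilon> d f \<longleftrightarrow>
     least_squares_solution \<Omega> \<epsilon> d f \<and>
     (\<forall>f'. least_squares_solution \<Omega> \<epsilon> d f' \<longrightarrow>
        L2_norm (lebesgue_on \<Omega>) f \<le> L2_norm (lebesgue_on \<Omega>) f')"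

text \<open>\<open>g\<close> is the trace of the state, so the first term is the norm of \<open>u - d\<close> in \<open>L\<^sup>2(\<partial>\<Omega>)\<close>.\<close>

definition tikhonov_functional ::
  "'a::euclidean_space set \<Rightarrow> ('a \<Rightarrow> real) \<Rightarrow> real \<Rightarrow> ('a \<Rightarrow> real) \<Rightarrow> ('a \<Rightarrow> real) \<Rightarrow> real" where
  "tikhonov_functional \<Omega> d \<alpha> f g =
     1/2 * (L2_norm (surface_measure \<Omega>) (\<lambda>x. g x - d x))\<^sup>2 + 1/2 * \<alpha> * (L2_norm (lebesgue_on \<Omega>) f)\<^sup>2"

definition tikhonov_solution ::
  "'a::euclidean_space set \<Rightarrow> real \<Rightarrow> ('a \<Rightarrow> real) \<Rightarrow> real \<Rightarrow> ('a \<Rightarrow> real) \<Rightarrow> ('a \<Rightarrow> real) \<Rightarrow> bool" where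
  "tikhonov_solution \<Omega> \<epsilon> d \<alpha> f u \<longleftrightarrow>
     f \<in> L2 (lebesgue_on \<Omega>) \<and> neumann_weak_solution \<Omega> \<epsilon> f u \<and>
     (\<exists>g. has_trace \<Omega> u g \<and>
       (\<forall>f' u' g'. f' \<in> L2 (lebesgue_on \<Omega>) \<and> neumann_weak_solution \<Omega> \<epsilon> f' u' \<and> has_trace \<Omega> u' g' \<longrightarrow>
          tikhonov_functional \<Omega> d \<alpha> f g \<le> tikhonov_functional \<Omega> d \<alpha> f' g'))"

end

(*
For a test function \<phi> put h = - \<Delta> \<phi> + \<epsilon> \<phi>. Then \<phi> itself is the weak Neumann solution with
source h, and its trace vanishes, so K h = 0. Hence f* + t h is a least-squares solution for every t,
and minimality of the norm of f* makes f* orthogonal to h. Integrating by parts twice shows that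
- \<Delta> f* + \<epsilon> f* is orthogonal to all test functions, hence zero. For the second claim, a
non-negative interior maximum must have value zero because \<Delta> f* = \<epsilon> f*, and Hopf's touching-ball
argument then forces f* = 0 on the whole domain.
*)
theory Submission
  imports Defs
begin

text \<open>Every integration by parts is against a test function, so the shape of the boundary
  never enters: the product, extended by zero, is differentiable on the whole space and has compact
  support. As the trace is a closure of restrictions, \<open>K h = 0\<close> is used in the form
  that adding a test function to a state preserves any trace \<open>g\<close> of that state. At a
  non-negative interior maximum the Laplacian is at most 0 but equals
  \<open>\<epsilon> * fstar\<close>, which gives the value zero. Hopf's barrier is here a quadratic
  polynomial instead of the usual exponential: on each coordinate line it is a polynomial in one
  variable, so the one-dimensional second derivative test suffices.\<close>

section \<open>Partial derivatives and smooth functions\<close>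

lemma partial_deriv_eq: "(f has_derivative f') (at x) \<Longrightarrow> partial_deriv i f x = f' i"
  unfolding partial_deriv_def by (metis frechet_derivative_at)

lemma has_derivative_partial:
  assumes "f differentiable (at x)"
  shows "(f has_derivative frechet_derivative f (at x)) (at x)"
  using assms by (simp add: frechet_derivative_works)

lemma partial_deriv_const [simp]: "partial_deriv i (\<lambda>_. c) = (\<lambda>_. 0)"
  by (rule ext, rule partial_deriv_eq[THEN trans]) (auto intro!: derivative_eq_intros)

lemma partial_deriv_inner: "partial_deriv i (\<lambda>x. x \<bullet> j) = (\<lambda>_. i \<bullet> j)"
  by (rule ext, rule partial_deriv_eq[THEN trans]) (auto intro!: derivative_eq_intros)

lemma partial_deriv_add:
  assumes "f differentiable (at x)" "g differentiable (at x)"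
  shows "partial_deriv i (\<lambda>x. f x + g x) x = partial_deriv i f x + partial_deriv i g x"
  using partial_deriv_eq[OF has_derivative_add[OF assms[THEN has_derivative_partial]]]
  by (simp add: partial_deriv_def)

lemma partial_deriv_mult:
  assumes "f differentiable (at x)" "g differentiable (at x)"
  shows "partial_deriv i (\<lambda>x. f x * g x) x = partial_deriv i f x * g x + f x * partial_deriv i g x"
  using partial_deriv_eq[OF has_derivative_mult[OF assms[THEN has_derivative_partial]]]
  by (simp add: partial_deriv_def)

lemma partial_deriv_cmult:
  assumes "f differentiable (at x)"
  shows "partial_deriv i (\<lambda>x. c * f x) x = c * partial_deriv i f x"
  using partial_deriv_eq[OF has_derivative_mult_right[OF has_derivative_partial[OF assms]]]
  by (simp add: partial_deriv_def)

text \<open>\<open>frechet_derivative\<close> is a choice among derivatives. Functions that agree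
  near \<open>x\<close> have the same derivatives there, so the choice coincides even where none
  exists.\<close>

lemma partial_deriv_transform:
  assumes "open U" "x \<in> U" "\<And>y. y \<in> U \<Longrightarrow> f y = g y"
  shows "partial_deriv i f x = partial_deriv i g x"
proof -
  have "(f has_derivative D) (at x) \<longleftrightarrow> (g has_derivative D) (at x)" for D
    using has_derivative_transform_within_open[of f D x UNIV U g]
      has_derivative_transform_within_open[of g D x UNIV U f] assms by auto
  then show ?thesis
    unfolding partial_deriv_def frechet_derivative_def by simp
qed

text \<open>The passage to one variable: mean value theorem, difference quotients and second
  derivative test are all applied on lines.\<close>

lemma has_real_derivative_line:
  assumes "f differentiable (at (p + t *\<^sub>R i))"
  shows "((\<lambda>t. f (p + t *\<^sub>R i)) has_real_derivative partial_deriv i f (p + t *\<^sub>R i)) (at t)"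
proof -
  let ?D = "frechet_derivative f (at (p + t *\<^sub>R i))"
  have D: "(f has_derivative ?D) (at (p + t *\<^sub>R i))" by (rule has_derivative_partial[OF assms])
  have "((\<lambda>t. f (p + t *\<^sub>R i)) has_derivative (\<lambda>s. ?D (s *\<^sub>R i))) (at t)"
    by (rule has_derivative_compose[of "\<lambda>t. p + t *\<^sub>R i" "\<lambda>s. s *\<^sub>R i"])
      (auto intro!: derivative_eq_intros D)
  moreover have "?D (s *\<^sub>R i) = partial_deriv i f (p + t *\<^sub>R i) * s" for s
    using linear_cmul[OF has_derivative_linear[OF D]] by (simp add: partial_deriv_def)
  ultimately show ?thesis by (simp add: has_field_derivative_def)
qed

lemma Ck_on_SucD: "Ck_on (Suc k) S f \<Longrightarrow> Ck_on k S f"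
proof (induction k arbitrary: f)
  case 0
  then show ?case
    by (auto intro!: continuous_at_imp_continuous_on differentiable_imp_continuous_within)
next
  case (Suc k)
  then show ?case by auto
qed

text \<open>On \<open>UNIV\<close> the differentiation rules become equations between functions,
  which can be rewritten under the recursion of \<open>Ck_on\<close>.\<close>

lemma Ck_on_UNIV_const: "Ck_on k UNIV (\<lambda>_. c)"
  by (induction k arbitrary: c) auto

lemma Ck_on_UNIV_inner: "Ck_on k UNIV (\<lambda>x. x \<bullet> j)"
proof (cases k)
  case (Suc m)
  have "(\<lambda>x. x \<bullet> j) differentiable (at x)" for x :: 'a
    by (intro bounded_linear_imp_differentiable bounded_linear_inner_left)
  then show ?thesis using Suc by (simp add: partial_deriv_inner Ck_on_UNIV_const)
qed (auto intro!: continuous_intros)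

lemma Ck_on_UNIV_add:
  "Ck_on k UNIV f \<Longrightarrow> Ck_on k UNIV g \<Longrightarrow> Ck_on k UNIV (\<lambda>x. f x + g x)"
proof (induction k arbitrary: f g)
  case (Suc k)
  then have "partial_deriv i (\<lambda>x. f x + g x) = (\<lambda>x. partial_deriv i f x + partial_deriv i g x)" for i
    by (intro ext partial_deriv_add) auto
  with Suc show ?case by auto
qed (simp add: continuous_on_add)

lemma Ck_on_UNIV_mult:
  "Ck_on k UNIV f \<Longrightarrow> Ck_on k UNIV g \<Longrightarrow> Ck_on k UNIV (\<lambda>x. f x * g x)"
proof (induction k arbitrary: f g)
  case (Suc k)
  then have "partial_deriv i (\<lambda>x. f x * g x)
      = (\<lambda>x. partial_deriv i f x * g x + f x * partial_deriv i g x)" for i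
    by (intro ext partial_deriv_mult) auto
  \<comment> \<open>Each Leibniz term has an undifferentiated factor of order \<open>Suc k\<close>;
    \<open>Ck_on_SucD\<close> lowers it so that the induction hypothesis fits.\<close>
  moreover have "Ck_on k UNIV (\<lambda>x. partial_deriv i f x * g x + f x * partial_deriv i g x)"
    if "i \<in> Basis" for i
    using Suc.prems that Suc.prems[THEN Ck_on_SucD] by (intro Ck_on_UNIV_add Suc.IH) auto
  ultimately show ?case using Suc.prems by (auto intro!: differentiable_mult)
qed (simp add: continuous_on_mult)

lemma smooth_on_UNIV_add_mult:
  assumes "smooth_on UNIV f" "smooth_on UNIV g"
  shows "smooth_on UNIV (\<lambda>x. f x + c * g x)"
  using assms unfolding smooth_on_def
  by (auto intro!: Ck_on_UNIV_add Ck_on_UNIV_mult Ck_on_UNIV_const)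

lemma smooth_onD:
  assumes "smooth_on S f"
  shows "x \<in> S \<Longrightarrow> f differentiable (at x)" "continuous_on S f"
    "i \<in> Basis \<Longrightarrow> smooth_on S (partial_deriv i f)"
proof -
  have "Ck_on (Suc k) S f" for k using assms unfolding smooth_on_def by blast
  then show "x \<in> S \<Longrightarrow> f differentiable (at x)"
    "i \<in> Basis \<Longrightarrow> smooth_on S (partial_deriv i f)" unfolding smooth_on_def by auto
  show "continuous_on S f" using assms unfolding smooth_on_def by (metis Ck_on.simps(1))
qed

lemma gradient_inner: "i \<in> Basis \<Longrightarrow> gradient f x \<bullet> i = partial_deriv i f x"
  by (simp add: gradient_def)

lemma gradient_add_mult:
  assumes "f differentiable (at x)" "g differentiable (at x)"
  shows "gradient (\<lambda>x. f x + c * g x) x = gradient f x + c *\<^sub>R gradient g x"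
  by (rule euclidean_eqI)
    (simp add: gradient_inner inner_add_left partial_deriv_add partial_deriv_cmult assms differentiable_mult)

section \<open>Test functions and integration by parts\<close>

lemma test_functionD:
  assumes "test_function \<Omega> \<phi>"
  shows "\<phi> differentiable (at x)" "continuous_on S \<phi>" "smooth_on UNIV \<phi>"
  using assms smooth_onD(1,2)[of UNIV \<phi>] unfolding test_function_def
  by (auto intro: continuous_on_subset)

text \<open>Off the closed support \<open>\<phi>\<close> agrees with the zero function on an open
  set.\<close>

lemma partial_deriv_support:
  "closure {x. partial_deriv i \<phi> x \<noteq> 0} \<subseteq> closure {x. \<phi> x \<noteq> 0}"
proof (rule closure_minimal)
  show "{x. partial_deriv i \<phi> x \<noteq> 0} \<subseteq> closure {x. \<phi> x \<noteq> 0}"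
  proof clarify
    fix x assume "partial_deriv i \<phi> x \<noteq> 0"
    moreover have "partial_deriv i \<phi> x = partial_deriv i (\<lambda>_. 0) x" if "x \<notin> closure {x. \<phi> x \<noteq> 0}"
      by (rule partial_deriv_transform[of "- closure {x. \<phi> x \<noteq> 0}"])
        (use that closure_subset[of "{x. \<phi> x \<noteq> 0}"] in auto)
    ultimately show "x \<in> closure {x. \<phi> x \<noteq> 0}" by auto
  qed
qed auto

text \<open>This stability allows derivatives of test functions to be inserted into weak identities
  and makes a second integration by parts possible.\<close>

lemma test_function_partial_deriv:
  assumes "test_function \<Omega> \<phi>" "i \<in> Basis"
  shows "test_function \<Omega> (partial_deriv i \<phi>)"
proof -
  have "compact (closure {x. partial_deriv i \<phi> x \<noteq> 0})"
    using assms partial_deriv_support[of i \<phi>] unfolding test_function_def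
    by (metis closed_closure compact_Int_closed inf.absorb_iff2)
  with assms partial_deriv_support[of i \<phi>] smooth_onD(3)[of UNIV \<phi> i] show ?thesis
    unfolding test_function_def by auto
qed

lemma integrable_continuous_compact_support:
  fixes f :: "'a::euclidean_space \<Rightarrow> real"
  assumes "continuous_on UNIV f" "compact K" "\<And>x. x \<notin> K \<Longrightarrow> f x = 0"
  shows "integrable lborel f"
proof -
  have "integrable lborel (\<lambda>x. indicator K x *\<^sub>R f x)"
    using assms by (intro borel_integrable_compact) (auto intro: continuous_on_subset)
  moreover have "(\<lambda>x. indicator K x *\<^sub>R f x) = f"
    using assms(3) by (intro ext) (metis indicator_simps(1,2) scaleR_one scaleR_zero_left)
  ultimately show ?thesis by simp
qed

text \<open>Difference quotients in direction \<open>i\<close> have integral zero by translation invariance, and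
  they converge dominatedly to the partial derivative.\<close>

lemma integral_partial_deriv_eq_0:
  fixes F :: "'a::euclidean_space \<Rightarrow> real"
  assumes diff: "\<And>x. F differentiable (at x)" and cont: "continuous_on UNIV (partial_deriv i F)"
    and K: "compact K" "\<And>x. x \<notin> K \<Longrightarrow> F x = 0" and i: "i \<in> Basis"
  shows "(\<integral>x. partial_deriv i F x \<partial>lborel) = 0"
proof -
  have contF: "continuous_on UNIV F"
    using diff by (simp add: continuous_at_imp_continuous_on differentiable_imp_continuous_within)
  have intF: "integrable lborel F"
    by (rule integrable_continuous_compact_support[OF contF K])
  have Fshift: "integrable lborel (\<lambda>x. F (c + x))" "(\<integral>x. F (c + x) \<partial>lborel) = (\<integral>x. F x \<partial>lborel)" for c
  proof -
    have [measurable]: "F \<in> borel_measurable borel" using contF by (rule borel_measurable_continuous_onI)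
    show "integrable lborel (\<lambda>x. F (c + x))"
      using intF integrable_distr_eq[of "(+) c" lborel borel F] by (simp add: lborel_distr_plus)
    show "(\<integral>x. F (c + x) \<partial>lborel) = (\<integral>x. F x \<partial>lborel)"
      using integral_distr[of "(+) c" lborel borel F] by (simp add: lborel_distr_plus)
  qed
  obtain \<rho> where \<rho>: "K \<subseteq> cball 0 \<rho>"
    using compact_imp_bounded[OF K(1)] bounded_subset_ballD[of K 0] ball_subset_cball by blast
  \<comment> \<open>\<open>K\<close> lies within radius \<open>\<rho>\<close> and the steps below
    have length at most 1, so the quotients vanish beyond \<open>\<rho> + 1\<close> and the
    mean-value points needed lie within \<open>\<rho> + 2\<close>.\<close>
  have "compact (partial_deriv i F ` cball 0 (\<rho> + 2))"
    by (intro compact_continuous_image) (use cont in \<open>auto intro: continuous_on_subset\<close>)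
  then obtain C where "\<forall>y\<in>partial_deriv i F ` cball 0 (\<rho> + 2). norm y \<le> C"
    by (meson compact_imp_bounded bounded_iff)
  then have C: "\<bar>partial_deriv i F x\<bar> \<le> C" if "x \<in> cball 0 (\<rho> + 2)" for x
    using that by simp
  \<comment> \<open>Difference quotients with step \<open>1 / Suc n\<close>; the shift stands on the
    left to match \<open>Fshift\<close>.\<close>
  define G where "G n x = (F (inverse (Suc n) *\<^sub>R i + x) - F x) * Suc n" for n :: nat and x
  have G0: "(\<integral>x. G n x \<partial>lborel) = 0" and intG: "integrable lborel (G n)" for n
    unfolding G_def using Fshift intF by auto
  have bnd: "norm (G n x) \<le> C * indicator (cball 0 (\<rho> + 1)) x" for n x
  proof (cases "x \<in> cball 0 (\<rho> + 1)")
    case True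
    have "\<exists>z. 0 < z \<and> z < inverse (Suc n) \<and>
        F (x + inverse (Suc n) *\<^sub>R i) - F (x + 0 *\<^sub>R i) = (inverse (Suc n) - 0) * partial_deriv i F (x + z *\<^sub>R i)"
      by (rule MVT2) (auto intro!: has_real_derivative_line diff)
    then obtain z where z: "0 < z" "z < inverse (Suc n)"
      and eq: "F (x + inverse (Suc n) *\<^sub>R i) - F x = inverse (Suc n) * partial_deriv i F (x + z *\<^sub>R i)"
      by auto
    have "inverse (Suc n) \<le> (1::real)" by (simp add: field_simps)
    with z have "z \<le> 1" by simp
    have "norm (x + z *\<^sub>R i) \<le> norm x + norm (z *\<^sub>R i)" by (rule norm_triangle_ineq)
    also have "\<dots> \<le> \<rho> + 2" using True z \<open>z \<le> 1\<close> i by simp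
    finally have "\<bar>partial_deriv i F (x + z *\<^sub>R i)\<bar> \<le> C" by (intro C) simp
    moreover have "G n x = partial_deriv i F (x + z *\<^sub>R i)"
      using eq unfolding G_def by (simp add: add.commute)
    ultimately show ?thesis using True by simp
  next
    case False
    have le1: "inverse (Suc n) \<le> (1::real)" by (simp add: field_simps)
    have "norm x \<le> norm (inverse (Suc n) *\<^sub>R i + x) + norm (inverse (Suc n) *\<^sub>R i)"
      using norm_triangle_ineq4[of "inverse (Suc n) *\<^sub>R i + x" "inverse (Suc n) *\<^sub>R i"] by simp
    then have "norm (inverse (Suc n) *\<^sub>R i + x) > \<rho>"
      using False le1 i by simp
    then have "F (inverse (Suc n) *\<^sub>R i + x) = 0" "F x = 0" using \<rho> False by (auto intro!: K(2))
    then show ?thesis using False by (simp add: G_def)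
  qed
  have lim: "(\<lambda>n. G n x) \<longlonglongrightarrow> partial_deriv i F x" for x
  proof -
    have "((\<lambda>t. F (x + t *\<^sub>R i)) has_real_derivative partial_deriv i F (x + 0 *\<^sub>R i)) (at 0)"
      by (rule has_real_derivative_line[OF diff])
    then have "((\<lambda>h. (F (x + h *\<^sub>R i) - F x) / h) \<longlongrightarrow> partial_deriv i F x) (at 0)"
      by (simp add: DERIV_def)
    moreover have "filterlim (\<lambda>n. inverse (real (Suc n))) (at 0) sequentially"
      unfolding filterlim_at using LIMSEQ_inverse_real_of_nat by auto
    ultimately have "(\<lambda>n. (F (x + inverse (real (Suc n)) *\<^sub>R i) - F x) / inverse (real (Suc n))) \<longlonglongrightarrow> partial_deriv i F x"
      by (rule filterlim_compose)
    then show ?thesis unfolding G_def by (simp add: field_simps add.commute)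
  qed
  have "(\<lambda>n. \<integral>x. G n x \<partial>lborel) \<longlonglongrightarrow> (\<integral>x. partial_deriv i F x \<partial>lborel)"
  proof (rule integral_dominated_convergence[where w = "\<lambda>x. C * indicator (cball 0 (\<rho> + 1)) x"])
    show "partial_deriv i F \<in> borel_measurable lborel"
      using cont by (simp add: borel_measurable_continuous_onI)
    show "integrable lborel (\<lambda>x::'a. C * indicator (cball 0 (\<rho> + 1)) x)"
      using emeasure_lborel_cball_finite[of "0::'a" "\<rho> + 1"]
      by (intro integrable_mult_right integrable_real_indicator) (simp_all add: less_top)
    show "G n \<in> borel_measurable lborel" for n by (rule borel_measurable_integrable[OF intG])
    show "AE x in lborel. norm (G n x) \<le> C * indicator (cball 0 (\<rho> + 1)) x" for n
      by (intro AE_I2 bnd)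
  qed (simp add: lim)
  then show ?thesis by (simp add: G0 LIMSEQ_const_iff)
qed

text \<open>\<open>\<Omega>\<close> and the complement of the closed support are open and cover the
  space; the function is a product on the first and zero on the second.\<close>

lemma continuous_on_extend_by_0:
  fixes g \<phi> :: "'a::euclidean_space \<Rightarrow> real"
  assumes "open \<Omega>" "continuous_on \<Omega> g" "continuous_on UNIV \<phi>" "closure {x. \<phi> x \<noteq> 0} \<subseteq> \<Omega>"
  shows "continuous_on UNIV (\<lambda>x. if x \<in> \<Omega> then g x * \<phi> x else 0)" (is "continuous_on _ ?h")
proof -
  define K where "K = closure {x. \<phi> x \<noteq> 0}"
  have "closed K" "K \<subseteq> \<Omega>" using assms(4) by (simp_all add: K_def)
  have "continuous_on \<Omega> ?h \<longleftrightarrow> continuous_on \<Omega> (\<lambda>x. g x * \<phi> x)"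
    by (intro continuous_on_cong) auto
  moreover have "continuous_on \<Omega> (\<lambda>x. g x * \<phi> x)"
    using assms by (intro continuous_on_mult) (auto intro: continuous_on_subset)
  moreover have "?h x = 0" if "x \<notin> K" for x
    using that closure_subset[of "{x. \<phi> x \<noteq> 0}"] by (auto simp: K_def)
  then have "continuous_on (- K) ?h \<longleftrightarrow> continuous_on (- K) (\<lambda>_. 0::real)"
    by (intro continuous_on_cong refl) blast
  ultimately have "continuous_on (\<Omega> \<union> - K) ?h"
    using \<open>open \<Omega>\<close> \<open>closed K\<close> by (intro continuous_on_open_Un) (simp_all add: open_Compl)
  moreover have "\<Omega> \<union> - K = UNIV" using \<open>K \<subseteq> \<Omega>\<close> by auto
  ultimately show ?thesis by simp
qed

lemma test_function_zero_outside: "test_function \<Omega> \<phi> \<Longrightarrow> x \<notin> closure {x. \<phi> x \<noteq> 0} \<Longrightarrow> \<phi> x = 0"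
  using closure_subset[of "{x. \<phi> x \<noteq> 0}"] by auto

text \<open>Moves between \<open>lebesgue_on \<Omega>\<close>, where the weak formulations live, and
  \<open>lborel\<close>, which is translation invariant. Compact support tames even a
  \<open>g\<close> that is unbounded near the boundary.\<close>

lemma test_function_integrable:
  fixes \<Omega> :: "'a::euclidean_space set"
  assumes "open \<Omega>" "continuous_on \<Omega> g" "test_function \<Omega> \<phi>"
  shows "integrable (lebesgue_on \<Omega>) (\<lambda>x. g x * \<phi> x)"
    and "(\<integral>x. g x * \<phi> x \<partial>lebesgue_on \<Omega>) = (\<integral>x. (if x \<in> \<Omega> then g x * \<phi> x else 0) \<partial>lborel)"
    and "integrable lborel (\<lambda>x. if x \<in> \<Omega> then g x * \<phi> x else 0)"
proof -
  have \<Omega>: "\<Omega> \<in> sets lebesgue" using \<open>open \<Omega>\<close> by (simp add: borel_open sets_completionI_sets)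
  let ?h = "\<lambda>x. if x \<in> \<Omega> then g x * \<phi> x else 0"
  have "continuous_on UNIV ?h"
    using assms by (intro continuous_on_extend_by_0) (auto simp: test_function_def intro: test_functionD)
  then show int: "integrable lborel ?h"
  proof (rule integrable_continuous_compact_support[of _ "closure {x. \<phi> x \<noteq> 0}"])
    show "?h x = 0" if "x \<notin> closure {x. \<phi> x \<noteq> 0}" for x
      using test_function_zero_outside[OF assms(3) that] by simp
  qed (use assms(3) in \<open>simp add: test_function_def\<close>)
  then have m: "?h \<in> borel_measurable lborel" by auto
  show "integrable (lebesgue_on \<Omega>) (\<lambda>x. g x * \<phi> x)"
    using int integrable_completion[OF m] Lebesgue_Measure.integrable_restrict_UNIV[OF \<Omega>, of "\<lambda>x. g x * \<phi> x"] by simp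
  show "(\<integral>x. g x * \<phi> x \<partial>lebesgue_on \<Omega>) = (\<integral>x. ?h x \<partial>lborel)"
    using integral_completion[OF m] Lebesgue_Measure.integral_restrict_UNIV[OF \<Omega>, of "\<lambda>x. g x * \<phi> x"] by simp
qed

text \<open>The product \<open>f * \<phi>\<close>, extended by zero, has a partial derivative of
  integral zero, and the product rule splits that integral.\<close>

lemma integration_by_parts_test_function:
  fixes \<Omega> :: "'a::euclidean_space set"
  assumes \<Omega>: "open \<Omega>" and f: "\<And>x. x \<in> \<Omega> \<Longrightarrow> f differentiable (at x)"
    and cont: "continuous_on \<Omega> (partial_deriv i f)"
    and \<phi>: "test_function \<Omega> \<phi>" and i: "i \<in> Basis"
  shows "(\<integral>x. f x * partial_deriv i \<phi> x \<partial>lebesgue_on \<Omega>) = - (\<integral>x. partial_deriv i f x * \<phi> x \<partial>lebesgue_on \<Omega>)"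
proof -
  let ?K = "closure {x. \<phi> x \<noteq> 0}"
  have contf: "continuous_on \<Omega> f"
    using f by (simp add: continuous_at_imp_continuous_on differentiable_imp_continuous_within)
  have \<phi>': "test_function \<Omega> (partial_deriv i \<phi>)" by (rule test_function_partial_deriv[OF \<phi> i])
  have KO: "?K \<subseteq> \<Omega>" "compact ?K" using \<phi> by (auto simp: test_function_def)
  define F where "F x = (if x \<in> \<Omega> then f x * \<phi> x else 0)" for x
  have F0: "F x = 0" if "x \<notin> ?K" for x
    using test_function_zero_outside[OF \<phi> that] by (simp add: F_def)
  have \<phi>'0: "partial_deriv i \<phi> x = 0" if "x \<notin> ?K" for x
    using that partial_deriv_support[of i \<phi>] test_function_zero_outside[OF \<phi>'] by blast
  have in_\<Omega>: "F differentiable (at x) \<and> partial_deriv i F x = partial_deriv i f x * \<phi> x + f x * partial_deriv i \<phi> x"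
    if "x \<in> \<Omega>" for x
  proof
    have "(\<lambda>x. f x * \<phi> x) differentiable (at x)"
      by (intro differentiable_mult f that test_functionD[OF \<phi>])
    then obtain D where "((\<lambda>x. f x * \<phi> x) has_derivative D) (at x)" by (auto simp: differentiable_def)
    then have "(F has_derivative D) (at x)"
      by (rule has_derivative_transform_within_open[OF _ \<Omega> that]) (simp add: F_def)
    then show "F differentiable (at x)" by (auto simp: differentiable_def)
    have "partial_deriv i F x = partial_deriv i (\<lambda>x. f x * \<phi> x) x"
      by (rule partial_deriv_transform[OF \<Omega> that]) (simp add: F_def)
    also have "\<dots> = partial_deriv i f x * \<phi> x + f x * partial_deriv i \<phi> x"
      by (intro partial_deriv_mult f that test_functionD[OF \<phi>])
    finally show "partial_deriv i F x = partial_deriv i f x * \<phi> x + f x * partial_deriv i \<phi> x" .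
  qed
  have out: "F differentiable (at x) \<and> partial_deriv i F x = 0" if "x \<notin> ?K" for x
  proof
    have "((\<lambda>_. 0) has_derivative (\<lambda>_. 0::real)) (at x)" by simp
    then have "(F has_derivative (\<lambda>_. 0)) (at x)"
      by (rule has_derivative_transform_within_open[of _ _ _ _ "- ?K"]) (use that F0 in auto)
    then show "F differentiable (at x)" by (auto simp: differentiable_def)
    show "partial_deriv i F x = 0" using partial_deriv_eq[OF \<open>(F has_derivative _) _\<close>] by simp
  qed
  let ?a = "\<lambda>x. if x \<in> \<Omega> then partial_deriv i f x * \<phi> x else 0"
  let ?b = "\<lambda>x. if x \<in> \<Omega> then f x * partial_deriv i \<phi> x else 0"
  have dF: "partial_deriv i F = (\<lambda>x. ?a x + ?b x)"
  proof
    fix x show "partial_deriv i F x = ?a x + ?b x"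
      using in_\<Omega>[of x] out[of x] KO by (cases "x \<in> \<Omega>") auto
  qed
  have "continuous_on UNIV ?a" "continuous_on UNIV ?b"
    using \<phi> \<phi>'
    by (auto intro!: continuous_on_extend_by_0 \<Omega> cont contf test_functionD(2)[OF \<phi>] test_functionD(2)[OF \<phi>']
        simp: test_function_def)
  then have "continuous_on UNIV (partial_deriv i F)" unfolding dF by (rule continuous_on_add)
  moreover have "F differentiable (at x)" for x using in_\<Omega>[of x] out[of x] KO by blast
  ultimately have "(\<integral>x. partial_deriv i F x \<partial>lborel) = 0"
    using i by (intro integral_partial_deriv_eq_0[OF _ _ KO(2) F0])
  then have "(\<integral>x. ?a x \<partial>lborel) + (\<integral>x. ?b x \<partial>lborel) = 0"
    unfolding dF using test_function_integrable(3)[OF \<Omega> cont \<phi>] test_function_integrable(3)[OF \<Omega> contf \<phi>']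
    by simp
  then show ?thesis
    unfolding test_function_integrable(2)[OF \<Omega> cont \<phi>] test_function_integrable(2)[OF \<Omega> contf \<phi>'] by simp
qed

section \<open>Inner products and orthogonality in the space of square-integrable functions\<close>

lemma L2_inner_integrable:
  fixes f g :: "'a \<Rightarrow> 'b::euclidean_space"
  assumes "f \<in> L2 M" "g \<in> L2 M"
  shows "integrable M (\<lambda>x. f x \<bullet> g x)"
proof (rule Bochner_Integration.integrable_bound)
  show "integrable M (\<lambda>x. (norm (f x))\<^sup>2 + (norm (g x))\<^sup>2)" using assms by (auto simp: L2_def)
  show "(\<lambda>x. f x \<bullet> g x) \<in> borel_measurable M" using assms by (auto simp: L2_def)
  show "AE x in M. norm (f x \<bullet> g x) \<le> norm ((norm (f x))\<^sup>2 + (norm (g x))\<^sup>2)"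
  proof (rule AE_I2)
    fix x
    have "\<bar>f x \<bullet> g x\<bar> \<le> norm (f x) * norm (g x)" by (rule Cauchy_Schwarz_ineq2)
    \<comment> \<open>Expanded, this is \<open>2 * a * b \<le> 2 * a^2 + 2 * b^2\<close> for the two
      norms \<open>a\<close> and \<open>b\<close>.\<close>
    moreover have "0 \<le> (norm (f x) - norm (g x))\<^sup>2 + (norm (f x))\<^sup>2 + (norm (g x))\<^sup>2" by simp
    ultimately show "norm (f x \<bullet> g x) \<le> norm ((norm (f x))\<^sup>2 + (norm (g x))\<^sup>2)"
      by (simp add: power2_diff)
  qed
qed

lemma integrable_L2_mult:
  fixes f g :: "'a \<Rightarrow> real"
  assumes "f \<in> L2 M" "g \<in> L2 M"
  shows "integrable M (\<lambda>x. f x * g x)"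
  using L2_inner_integrable[OF assms] by simp

lemma L2_add_mult:
  fixes f g :: "'a \<Rightarrow> 'b::euclidean_space"
  assumes "f \<in> L2 M" "g \<in> L2 M"
  shows "(\<lambda>x. f x + c *\<^sub>R g x) \<in> L2 M"
    and "(L2_norm M (\<lambda>x. f x + c *\<^sub>R g x))\<^sup>2
      = (L2_norm M f)\<^sup>2 + 2 * c * (\<integral>x. f x \<bullet> g x \<partial>M) + c\<^sup>2 * (L2_norm M g)\<^sup>2"
proof -
  have eq: "(norm (f x + c *\<^sub>R g x))\<^sup>2 = (norm (f x))\<^sup>2 + (2 * c * (f x \<bullet> g x) + c\<^sup>2 * (norm (g x))\<^sup>2)" for x
    unfolding power2_norm_eq_inner
    by (simp add: inner_add_left inner_add_right inner_commute power2_eq_square algebra_simps)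
  have int: "integrable M (\<lambda>x. (norm (f x))\<^sup>2)" "integrable M (\<lambda>x. (norm (g x))\<^sup>2)"
    "integrable M (\<lambda>x. f x \<bullet> g x)"
    using assms L2_inner_integrable[OF assms] by (auto simp: L2_def)
  show "(\<lambda>x. f x + c *\<^sub>R g x) \<in> L2 M"
    using assms int unfolding L2_def mem_Collect_eq eq by auto
  have sq: "(L2_norm M h)\<^sup>2 = (\<integral>x. (norm (h x))\<^sup>2 \<partial>M)" for h :: "'a \<Rightarrow> 'b"
    unfolding L2_norm_def by (simp add: integral_nonneg_AE)
  show "(L2_norm M (\<lambda>x. f x + c *\<^sub>R g x))\<^sup>2
      = (L2_norm M f)\<^sup>2 + 2 * c * (\<integral>x. f x \<bullet> g x \<partial>M) + c\<^sup>2 * (L2_norm M g)\<^sup>2"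
    unfolding sq eq using int by simp
qed

text \<open>The squared norm is a quadratic polynomial in \<open>t\<close> whose linear coefficient
  is twice the inner product; a minimum at \<open>t = 0\<close> forces that coefficient to
  vanish.\<close>

lemma L2_orthogonal_of_minimal:
  fixes f g :: "'a \<Rightarrow> 'b::euclidean_space"
  assumes "f \<in> L2 M" "g \<in> L2 M" "\<And>t. L2_norm M f \<le> L2_norm M (\<lambda>x. f x + t *\<^sub>R g x)"
  shows "(\<integral>x. f x \<bullet> g x \<partial>M) = 0"
proof (rule ccontr)
  define b where "b = (\<integral>x. f x \<bullet> g x \<partial>M)"
  define c where "c = (L2_norm M g)\<^sup>2"
  assume "(\<integral>x. f x \<bullet> g x \<partial>M) \<noteq> 0"
  then have "b \<noteq> 0" by (simp add: b_def)
  have *: "0 \<le> 2 * t * b + t\<^sup>2 * c" for t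
  proof -
    have "(L2_norm M f)\<^sup>2 \<le> (L2_norm M (\<lambda>x. f x + t *\<^sub>R g x))\<^sup>2"
      by (intro power_mono assms(3)) (simp add: L2_norm_def integral_nonneg_AE)
    then show ?thesis using L2_add_mult(2)[OF assms(1,2), of t] by (simp add: b_def c_def)
  qed
  have "c \<ge> 0" by (simp add: c_def)
  \<comment> \<open>The minimiser of the quadratic would be \<open>- b / c\<close>; the added 1
    covers \<open>c = 0\<close>, and the value at \<open>- q\<close> is still negative, namely
    \<open>- (q^2 * (c + 2))\<close>.\<close>
  define q where "q = b / (c + 1)"
  have "b = q * (c + 1)" using \<open>c \<ge> 0\<close> by (simp add: q_def)
  then have "2 * (- q) * b + (- q)\<^sup>2 * c = - (q\<^sup>2 * (c + 2))"
    by (simp add: algebra_simps power2_eq_square)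
  moreover have "q\<^sup>2 * (c + 2) > 0" unfolding q_def using \<open>b \<noteq> 0\<close> \<open>c \<ge> 0\<close> by simp
  ultimately show False using *[of "- q"] by linarith
qed

lemma test_function_L2:
  fixes \<Omega> :: "'a::euclidean_space set"
  assumes "open \<Omega>" "test_function \<Omega> \<phi>"
  shows "\<phi> \<in> L2 (lebesgue_on \<Omega>)"
proof -
  have "integrable (lebesgue_on \<Omega>) (\<lambda>x. \<phi> x * \<phi> x)"
    by (intro test_function_integrable(1) assms test_functionD(2)[OF assms(2)])
  \<comment> \<open>Taken for the measurability of \<open>\<phi>\<close> that integrability
    contains.\<close>
  moreover have "integrable (lebesgue_on \<Omega>) (\<lambda>x. 1 * \<phi> x)"
    by (intro test_function_integrable(1) assms continuous_on_const)
  ultimately show ?thesis by (auto simp: L2_def power2_eq_square)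
qed

lemma L2_sum:
  fixes f :: "'i \<Rightarrow> 'a \<Rightarrow> 'b::euclidean_space"
  assumes "finite I" "\<And>i. i \<in> I \<Longrightarrow> f i \<in> L2 M"
  shows "(\<lambda>x. \<Sum>i\<in>I. f i x) \<in> L2 M"
  using assms
proof (induction I rule: finite_induct)
  case empty
  then show ?case by (simp add: L2_def)
next
  case (insert i I)
  then show ?case using L2_add_mult(1)[of "f i" M "\<lambda>x. \<Sum>i\<in>I. f i x" 1] by simp
qed

lemma L2_scaleR_const:
  fixes f :: "'a \<Rightarrow> real" and b :: "'b::euclidean_space"
  assumes "f \<in> L2 M"
  shows "(\<lambda>x. f x *\<^sub>R b) \<in> L2 M"
  using assms by (auto simp: L2_def power_mult_distrib)

section \<open>Test functions as states of the Neumann problem\<close>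

lemma test_function_H1:
  fixes \<Omega> :: "'a::euclidean_space set"
  assumes \<Omega>: "open \<Omega>" and \<phi>: "test_function \<Omega> \<phi>"
  shows "H1_grad \<Omega> \<phi> (gradient \<phi>)"
proof -
  have "gradient \<phi> \<in> L2 (lebesgue_on \<Omega>)"
    unfolding gradient_def[abs_def]
    by (intro L2_sum L2_scaleR_const test_function_L2[OF \<Omega>] test_function_partial_deriv \<phi>) auto
  moreover have "(\<integral>x. \<phi> x * partial_deriv i \<psi> x \<partial>lebesgue_on \<Omega>)
      = - (\<integral>x. (gradient \<phi> x \<bullet> i) * \<psi> x \<partial>lebesgue_on \<Omega>)"
    if "test_function \<Omega> \<psi>" "i \<in> Basis" for \<psi> i
    unfolding gradient_inner[OF that(2)] using that
    by (intro integration_by_parts_test_function \<Omega> test_functionD(1)[OF \<phi>]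
        test_functionD(2)[OF test_function_partial_deriv[OF \<phi>]])
  ultimately show ?thesis
    unfolding H1_grad_def using test_function_L2[OF \<Omega> \<phi>] by blast
qed

lemma test_function_helmholtz_L2:
  fixes \<Omega> :: "'a::euclidean_space set"
  assumes \<Omega>: "open \<Omega>" and \<phi>: "test_function \<Omega> \<phi>"
  shows "(\<lambda>x. - laplacian \<phi> x + \<epsilon> * \<phi> x) \<in> L2 (lebesgue_on \<Omega>)"
proof -
  have "laplacian \<phi> \<in> L2 (lebesgue_on \<Omega>)"
    unfolding laplacian_def[abs_def]
    by (intro L2_sum test_function_L2[OF \<Omega>] test_function_partial_deriv \<phi>) auto
  from L2_add_mult(1)[OF L2_scaleR_const[OF test_function_L2[OF assms], of \<epsilon>] this, of "-1"]
  show ?thesis by (simp add: algebra_simps)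
qed

text \<open>The competitor \<open>v\<close> need not vanish on the boundary. No boundary term
  appears because the weak gradient of \<open>v\<close> is tested with
  \<open>partial_deriv i \<phi>\<close>, which is itself a test function.\<close>

lemma test_function_neumann_weak_solution:
  fixes \<Omega> :: "'a::euclidean_space set"
  assumes \<Omega>: "open \<Omega>" and \<phi>: "test_function \<Omega> \<phi>"
  shows "neumann_weak_solution \<Omega> \<epsilon> (\<lambda>x. - laplacian \<phi> x + \<epsilon> * \<phi> x) \<phi>"
  unfolding neumann_weak_solution_def
proof (intro exI conjI allI impI)
  show "H1_grad \<Omega> \<phi> (gradient \<phi>)" by (rule test_function_H1[OF assms])
  fix v Dv assume v: "H1_grad \<Omega> v Dv"
  let ?M = "lebesgue_on \<Omega>"
  have vL2: "v \<in> L2 ?M" and DvL2: "Dv \<in> L2 ?M" using v by (auto simp: H1_grad_def)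
  have DviL2: "(\<lambda>x. Dv x \<bullet> i) \<in> L2 ?M" if "i \<in> Basis" for i
  proof -
    have "integrable ?M (\<lambda>x. (Dv x \<bullet> i)\<^sup>2)"
    proof (rule Bochner_Integration.integrable_bound[where f = "\<lambda>x. (norm (Dv x))\<^sup>2"])
      show "AE x in ?M. norm ((Dv x \<bullet> i)\<^sup>2) \<le> norm ((norm (Dv x))\<^sup>2)"
        using Basis_le_norm[OF that] by (auto intro!: AE_I2 simp flip: abs_le_square_iff)
    qed (use DvL2 in \<open>auto simp: L2_def\<close>)
    then show ?thesis using DvL2 by (auto simp: L2_def)
  qed
  have D1: "partial_deriv i \<phi> \<in> L2 ?M" and D2: "partial_deriv i (partial_deriv i \<phi>) \<in> L2 ?M"
    and t1: "test_function \<Omega> (partial_deriv i \<phi>)" if "i \<in> Basis" for i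
    using that by (auto intro!: test_function_L2[OF \<Omega>] test_function_partial_deriv \<phi>)
  have "(\<integral>x. gradient \<phi> x \<bullet> Dv x \<partial>?M) = (\<integral>x. (\<Sum>i\<in>Basis. partial_deriv i \<phi> x * (Dv x \<bullet> i)) \<partial>?M)"
    unfolding gradient_def inner_sum_left by (simp add: inner_commute)
  also have "\<dots> = (\<Sum>i\<in>Basis. \<integral>x. partial_deriv i \<phi> x * (Dv x \<bullet> i) \<partial>?M)"
    by (intro Bochner_Integration.integral_sum integrable_L2_mult D1 DviL2)
  also have "\<dots> = (\<Sum>i\<in>Basis. - (\<integral>x. v x * partial_deriv i (partial_deriv i \<phi>) x \<partial>?M))"
    using v t1 by (intro sum.cong) (auto simp: H1_grad_def mult.commute)
  also have "\<dots> = - (\<integral>x. (\<Sum>i\<in>Basis. v x * partial_deriv i (partial_deriv i \<phi>) x) \<partial>?M)"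
    unfolding sum_negf
    by (subst Bochner_Integration.integral_sum) (intro integrable_L2_mult D2 vL2 | simp)+
  also have "\<dots> = - (\<integral>x. laplacian \<phi> x * v x \<partial>?M)"
    by (simp add: laplacian_def sum_distrib_left mult.commute)
  finally have grad: "(\<integral>x. gradient \<phi> x \<bullet> Dv x \<partial>?M) = - (\<integral>x. laplacian \<phi> x * v x \<partial>?M)" .
  have L: "laplacian \<phi> \<in> L2 ?M"
    unfolding laplacian_def[abs_def] by (intro L2_sum D2) auto
  have "(\<integral>x. (- laplacian \<phi> x + \<epsilon> * \<phi> x) * v x \<partial>?M)
      = (\<integral>x. - (laplacian \<phi> x * v x) + \<epsilon> * (\<phi> x * v x) \<partial>?M)"
    by (simp add: algebra_simps)
  also have "\<dots> = - (\<integral>x. laplacian \<phi> x * v x \<partial>?M) + \<epsilon> * (\<integral>x. \<phi> x * v x \<partial>?M)"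
    using integrable_L2_mult[OF L vL2] integrable_L2_mult[OF test_function_L2[OF assms] vL2] by simp
  finally show "(\<integral>x. gradient \<phi> x \<bullet> Dv x \<partial>?M) + \<epsilon> * (\<integral>x. \<phi> x * v x \<partial>?M)
      = (\<integral>x. (- laplacian \<phi> x + \<epsilon> * \<phi> x) * v x \<partial>?M)" using grad by simp
qed

section \<open>Linearity of the weak problem and orthogonality of the minimum-norm solution\<close>

lemma H1_grad_add_mult:
  assumes u: "H1_grad \<Omega> u Du" and v: "H1_grad \<Omega> v Dv" and \<Omega>: "open \<Omega>"
  shows "H1_grad \<Omega> (\<lambda>x. u x + c * v x) (\<lambda>x. Du x + c *\<^sub>R Dv x)"
  unfolding H1_grad_def
proof (intro conjI allI impI ballI)
  let ?M = "lebesgue_on \<Omega>"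
  show "(\<lambda>x. u x + c * v x) \<in> L2 ?M" "(\<lambda>x. Du x + c *\<^sub>R Dv x) \<in> L2 ?M"
    using L2_add_mult(1)[of u ?M v c] L2_add_mult(1)[of Du ?M Dv c] u v by (auto simp: H1_grad_def)
  fix \<phi> i assume \<phi>: "test_function \<Omega> \<phi>" and i: "i \<in> (Basis :: 'a set)"
  have p: "partial_deriv i \<phi> \<in> L2 ?M" "\<phi> \<in> L2 ?M"
    using \<phi> i \<Omega> by (auto intro!: test_function_L2 test_function_partial_deriv)
  have int1: "integrable ?M (\<lambda>x. w x * partial_deriv i \<phi> x)" "integrable ?M (\<lambda>x. (Dw x \<bullet> i) * \<phi> x)"
    if w: "H1_grad \<Omega> w Dw" for w Dw
  proof -
    show "integrable ?M (\<lambda>x. w x * partial_deriv i \<phi> x)"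
      using w p by (intro integrable_L2_mult) (auto simp: H1_grad_def)
    \<comment> \<open>The scalar product is regrouped as an inner product of two square-integrable
      vector fields.\<close>
    have "integrable ?M (\<lambda>x. Dw x \<bullet> (\<phi> x *\<^sub>R i))"
      using w p by (intro L2_inner_integrable L2_scaleR_const) (auto simp: H1_grad_def)
    then show "integrable ?M (\<lambda>x. (Dw x \<bullet> i) * \<phi> x)" by (simp add: mult.commute)
  qed
  have "(\<integral>x. (u x + c * v x) * partial_deriv i \<phi> x \<partial>?M)
      = (\<integral>x. u x * partial_deriv i \<phi> x + c * (v x * partial_deriv i \<phi> x) \<partial>?M)"
    by (simp add: algebra_simps)
  also have "\<dots> = (\<integral>x. u x * partial_deriv i \<phi> x \<partial>?M) + c * (\<integral>x. v x * partial_deriv i \<phi> x \<partial>?M)"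
    using int1(1)[OF u] int1(1)[OF v] by simp
  also have "\<dots> = - ((\<integral>x. (Du x \<bullet> i) * \<phi> x \<partial>?M) + c * (\<integral>x. (Dv x \<bullet> i) * \<phi> x \<partial>?M))"
    using u v \<phi> i by (simp add: H1_grad_def)
  also have "\<dots> = - (\<integral>x. (Du x \<bullet> i) * \<phi> x + c * ((Dv x \<bullet> i) * \<phi> x) \<partial>?M)"
    using int1(2)[OF u] int1(2)[OF v] by simp
  also have "\<dots> = - (\<integral>x. ((Du x + c *\<^sub>R Dv x) \<bullet> i) * \<phi> x \<partial>?M)"
    by (simp add: algebra_simps inner_add_left)
  finally show "(\<integral>x. (u x + c * v x) * partial_deriv i \<phi> x \<partial>?M)
      = - (\<integral>x. ((Du x + c *\<^sub>R Dv x) \<bullet> i) * \<phi> x \<partial>?M)" .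
qed

lemma neumann_weak_solution_add_mult:
  assumes "neumann_weak_solution \<Omega> \<epsilon> f u" "neumann_weak_solution \<Omega> \<epsilon> h v"
    and f: "f \<in> L2 (lebesgue_on \<Omega>)" and h: "h \<in> L2 (lebesgue_on \<Omega>)" and \<Omega>: "open \<Omega>"
  shows "neumann_weak_solution \<Omega> \<epsilon> (\<lambda>x. f x + c * h x) (\<lambda>x. u x + c * v x)"
proof -
  let ?M = "lebesgue_on \<Omega>"
  obtain Du where Du: "H1_grad \<Omega> u Du" and equ: "\<And>w Dw. H1_grad \<Omega> w Dw \<Longrightarrow>
    (\<integral>x. Du x \<bullet> Dw x \<partial>?M) + \<epsilon> * (\<integral>x. u x * w x \<partial>?M) = (\<integral>x. f x * w x \<partial>?M)"
    using assms(1) unfolding neumann_weak_solution_def by blast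
  obtain Dv where Dv: "H1_grad \<Omega> v Dv" and eqv: "\<And>w Dw. H1_grad \<Omega> w Dw \<Longrightarrow>
    (\<integral>x. Dv x \<bullet> Dw x \<partial>?M) + \<epsilon> * (\<integral>x. v x * w x \<partial>?M) = (\<integral>x. h x * w x \<partial>?M)"
    using assms(2) unfolding neumann_weak_solution_def by blast
  show ?thesis unfolding neumann_weak_solution_def
  proof (intro exI conjI allI impI)
    show "H1_grad \<Omega> (\<lambda>x. u x + c * v x) (\<lambda>x. Du x + c *\<^sub>R Dv x)" by (rule H1_grad_add_mult[OF Du Dv \<Omega>])
    fix w Dw assume w: "H1_grad \<Omega> w Dw"
    have L2: "u \<in> L2 ?M" "v \<in> L2 ?M" "w \<in> L2 ?M" "Du \<in> L2 ?M" "Dv \<in> L2 ?M" "Dw \<in> L2 ?M"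
      using Du Dv w by (auto simp: H1_grad_def)
    have 1: "(\<integral>x. (Du x + c *\<^sub>R Dv x) \<bullet> Dw x \<partial>?M) = (\<integral>x. Du x \<bullet> Dw x \<partial>?M) + c * (\<integral>x. Dv x \<bullet> Dw x \<partial>?M)"
      unfolding inner_add_left inner_scaleR_left
      using L2_inner_integrable[OF L2(4,6)] L2_inner_integrable[OF L2(5,6)] by simp
    have 2: "(\<integral>x. (a x + c * b x) * w x \<partial>?M) = (\<integral>x. a x * w x \<partial>?M) + c * (\<integral>x. b x * w x \<partial>?M)"
      if "a \<in> L2 ?M" "b \<in> L2 ?M" for a b
      unfolding distrib_right mult.assoc
      using integrable_L2_mult[OF that(1) L2(3)] integrable_L2_mult[OF that(2) L2(3)] by simp
    show "(\<integral>x. (Du x + c *\<^sub>R Dv x) \<bullet> Dw x \<partial>?M) + \<epsilon> * (\<integral>x. (u x + c * v x) * w x \<partial>?M)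
        = (\<integral>x. (f x + c * h x) * w x \<partial>?M)"
      unfolding 1 2[OF L2(1,2)] 2[OF f h] equ[OF w, symmetric] eqv[OF w, symmetric]
      by (simp add: algebra_simps)
  qed
qed

text \<open>A test function vanishes near the boundary, so adding it to an approximating sequence
  changes neither the errors in the interior nor the boundary values.\<close>

lemma has_trace_add_test_function:
  assumes g: "has_trace \<Omega> u g" and \<phi>: "test_function \<Omega> \<phi>" and \<Omega>: "open \<Omega>"
  shows "has_trace \<Omega> (\<lambda>x. u x + c * \<phi> x) g"
proof -
  obtain Du w where Du: "H1_grad \<Omega> u Du" and w: "\<And>k. smooth_on UNIV (w k)"
    and lim: "L2_tendsto (lebesgue_on \<Omega>) w u sequentially"
      "L2_tendsto (lebesgue_on \<Omega>) (\<lambda>k. gradient (w k)) Du sequentially"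
      "L2_tendsto (surface_measure \<Omega>) w g sequentially"
    using g unfolding has_trace_def by blast
  define w' where "w' k x = w k x + c * \<phi> x" for k x
  have w': "smooth_on UNIV (w' k)" for k
    unfolding w'_def[abs_def] by (intro smooth_on_UNIV_add_mult w test_functionD(3)[OF \<phi>])
  have "gradient (w' k) x = gradient (w k) x + c *\<^sub>R gradient \<phi> x" for k x
    unfolding w'_def[abs_def]
    by (intro gradient_add_mult test_functionD(1)[OF \<phi>] smooth_onD(1)[OF w]) simp
  then have 1: "L2_tendsto (lebesgue_on \<Omega>) (\<lambda>k. gradient (w' k)) (\<lambda>x. Du x + c *\<^sub>R gradient \<phi> x) sequentially"
    using lim(2) by (simp add: L2_tendsto_def)
  have 2: "L2_tendsto (lebesgue_on \<Omega>) w' (\<lambda>x. u x + c * \<phi> x) sequentially"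
    using lim(1) by (simp add: L2_tendsto_def w'_def)
  \<comment> \<open>\<open>L2\<close> and \<open>L2_norm\<close> of the surface measure see only its
    space, the frontier, which is disjoint from the open set \<open>\<Omega>\<close>.\<close>
  have "w' k x - g x = w k x - g x" if "x \<in> space (surface_measure \<Omega>)" for k x
  proof -
    have "x \<notin> \<Omega>"
      using that \<Omega> by (auto simp: surface_measure_def space_restrict_space frontier_def interior_open)
    moreover have "closure {x. \<phi> x \<noteq> 0} \<subseteq> \<Omega>" using \<phi> by (simp add: test_function_def)
    ultimately have "\<phi> x = 0" using test_function_zero_outside[OF \<phi>] by blast
    then show ?thesis by (simp add: w'_def)
  qed
  then have "(\<lambda>x. w' k x - g x) \<in> L2 (surface_measure \<Omega>) \<longleftrightarrow> (\<lambda>x. w k x - g x) \<in> L2 (surface_measure \<Omega>)"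
    "L2_norm (surface_measure \<Omega>) (\<lambda>x. w' k x - g x) = L2_norm (surface_measure \<Omega>) (\<lambda>x. w k x - g x)" for k
    unfolding L2_def L2_norm_def
    by (auto cong: measurable_cong Bochner_Integration.integrable_cong Bochner_Integration.integral_cong)
  then have 3: "L2_tendsto (surface_measure \<Omega>) w' g sequentially"
    using lim(3) by (simp add: L2_tendsto_def)
  show ?thesis
    unfolding has_trace_def
    using g H1_grad_add_mult[OF Du test_function_H1[OF \<Omega> \<phi>] \<Omega>] w' 1 2 3
    by (auto simp: has_trace_def)
qed

lemma moore_penrose_orthogonal:
  assumes mp: "moore_penrose_solution \<Omega> \<epsilon> d f" and \<phi>: "test_function \<Omega> \<phi>" and \<Omega>: "open \<Omega>"
  shows "(\<integral>x. f x * (- laplacian \<phi> x + \<epsilon> * \<phi> x) \<partial>lebesgue_on \<Omega>) = 0"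
proof -
  let ?M = "lebesgue_on \<Omega>" and ?h = "\<lambda>x. - laplacian \<phi> x + \<epsilon> * \<phi> x"
  obtain g where fg: "forward_op \<Omega> \<epsilon> f g" and min: "\<And>f' g'. forward_op \<Omega> \<epsilon> f' g' \<Longrightarrow>
      L2_norm (surface_measure \<Omega>) (\<lambda>x. g x - d x) \<le> L2_norm (surface_measure \<Omega>) (\<lambda>x. g' x - d x)"
    using mp unfolding moore_penrose_solution_def least_squares_solution_def by blast
  obtain u where f: "f \<in> L2 ?M" and u: "neumann_weak_solution \<Omega> \<epsilon> f u" "has_trace \<Omega> u g"
    using fg unfolding forward_op_def by blast
  have h: "?h \<in> L2 ?M" by (rule test_function_helmholtz_L2[OF \<Omega> \<phi>])
  have "L2_norm ?M f \<le> L2_norm ?M (\<lambda>x. f x + t *\<^sub>R ?h x)" for t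
  proof -
    \<comment> \<open>The same datum \<open>g\<close> is kept, so the residual bound
      \<open>min\<close> carries over verbatim.\<close>
    have "forward_op \<Omega> \<epsilon> (\<lambda>x. f x + t * ?h x) g"
      unfolding forward_op_def
      using L2_add_mult(1)[OF f h, of t] has_trace_add_test_function[OF u(2) \<phi> \<Omega>, of t]
        neumann_weak_solution_add_mult[OF u(1) test_function_neumann_weak_solution[OF \<Omega> \<phi>] f h \<Omega>, of t]
      by auto
    then have "least_squares_solution \<Omega> \<epsilon> d (\<lambda>x. f x + t * ?h x)"
      unfolding least_squares_solution_def using min by blast
    then show ?thesis using mp unfolding moore_penrose_solution_def by simp
  qed
  from L2_orthogonal_of_minimal[OF f h this] show ?thesis by simp
qed

lemma integral_helmholtz_eq_0:
  assumes \<Omega>: "open \<Omega>" and f: "\<And>x. x \<in> \<Omega> \<Longrightarrow> f differentiable (at x)" "continuous_on \<Omega> f"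
    and f1: "\<And>i x. i \<in> Basis \<Longrightarrow> x \<in> \<Omega> \<Longrightarrow> partial_deriv i f differentiable (at x)"
    and f2: "\<And>i. i \<in> Basis \<Longrightarrow> continuous_on \<Omega> (partial_deriv i (partial_deriv i f))"
    and mp: "moore_penrose_solution \<Omega> \<epsilon> d f" and \<phi>: "test_function \<Omega> \<phi>"
  shows "(\<integral>x. (- laplacian f x + \<epsilon> * f x) * \<phi> x \<partial>lebesgue_on \<Omega>) = 0"
proof -
  let ?M = "lebesgue_on \<Omega>"
  have t: "test_function \<Omega> (partial_deriv i \<phi>)" "test_function \<Omega> (partial_deriv i (partial_deriv i \<phi>))"
    if "i \<in> Basis" for i using that by (auto intro!: test_function_partial_deriv \<phi>)
  have cont1: "continuous_on \<Omega> (partial_deriv i f)" if "i \<in> Basis" for i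
    using f1[OF that] by (simp add: continuous_at_imp_continuous_on differentiable_imp_continuous_within)
  \<comment> \<open>The first integration by parts pairs \<open>f\<close> with
    \<open>partial_deriv i \<phi>\<close>, the second \<open>partial_deriv i f\<close> with
    \<open>\<phi>\<close>; the two signs cancel.\<close>
  have eq: "(\<integral>x. f x * partial_deriv i (partial_deriv i \<phi>) x \<partial>?M)
      = (\<integral>x. partial_deriv i (partial_deriv i f) x * \<phi> x \<partial>?M)" if i: "i \<in> Basis" for i
    using integration_by_parts_test_function[OF \<Omega> f(1) cont1[OF i] t(1)[OF i] i]
      integration_by_parts_test_function[OF \<Omega> f1[OF i] f2[OF i] \<phi> i] by simp
  have int: "integrable ?M (\<lambda>x. f x * partial_deriv i (partial_deriv i \<phi>) x)"
    "integrable ?M (\<lambda>x. partial_deriv i (partial_deriv i f) x * \<phi> x)" if "i \<in> Basis" for i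
    using that by (auto intro!: test_function_integrable(1) \<Omega> f f2 \<phi> t)
  have int0: "integrable ?M (\<lambda>x. f x * \<phi> x)" by (intro test_function_integrable(1) \<Omega> f \<phi>)
  have "(\<integral>x. (- laplacian f x + \<epsilon> * f x) * \<phi> x \<partial>?M)
      = (\<integral>x. - (\<Sum>i\<in>Basis. partial_deriv i (partial_deriv i f) x * \<phi> x) + \<epsilon> * (f x * \<phi> x) \<partial>?M)"
    unfolding laplacian_def sum_distrib_right[symmetric] by (simp add: algebra_simps)
  also have "\<dots> = - (\<Sum>i\<in>Basis. \<integral>x. partial_deriv i (partial_deriv i f) x * \<phi> x \<partial>?M) + \<epsilon> * (\<integral>x. f x * \<phi> x \<partial>?M)"
    using int int0 by simp
  also have "\<dots> = - (\<Sum>i\<in>Basis. \<integral>x. f x * partial_deriv i (partial_deriv i \<phi>) x \<partial>?M) + \<epsilon> * (\<integral>x. f x * \<phi> x \<partial>?M)"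
    by (simp add: eq)
  also have "\<dots> = (\<integral>x. - (\<Sum>i\<in>Basis. f x * partial_deriv i (partial_deriv i \<phi>) x) + \<epsilon> * (f x * \<phi> x) \<partial>?M)"
    using int int0 by simp
  also have "\<dots> = (\<integral>x. f x * (- laplacian \<phi> x + \<epsilon> * \<phi> x) \<partial>?M)"
    unfolding laplacian_def sum_distrib_left[symmetric] by (simp add: algebra_simps)
  also have "\<dots> = 0" by (rule moore_penrose_orthogonal[OF mp \<phi> \<Omega>])
  finally show ?thesis .
qed

section \<open>Smooth bumps and the fundamental lemma of the calculus of variations\<close>

text \<open>For \<open>m = 0\<close> this is the classical \<open>exp (- 1 / t)\<close>. The powers
  of \<open>1 / t\<close> are what differentiation produces, so linear combinations of the family
  are closed under derivatives.\<close>

definition cutoff :: "nat \<Rightarrow> real \<Rightarrow> real" where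
  "cutoff m t = (if t > 0 then exp (- inverse t) * inverse t ^ m else 0)"

text \<open>This is the difference quotient at 0. From the right, \<open>s = 1 / t\<close> turns it
  into a power of \<open>s\<close> divided by \<open>exp s\<close>.\<close>

lemma cutoff_div_tendsto_0: "((\<lambda>t. cutoff m t / t) \<longlongrightarrow> 0) (at 0)"
proof (rule filterlim_split_at)
  show "((\<lambda>t. cutoff m t / t) \<longlongrightarrow> 0) (at_left 0)"
    by (rule tendsto_eventually) (auto simp: eventually_at_left_field cutoff_def intro: exI[of _ "-1"])
  have "((\<lambda>s::real. s ^ Suc m / exp s) \<longlongrightarrow> 0) at_top" by (rule tendsto_power_div_exp_0)
  then have "((\<lambda>t::real. inverse t ^ Suc m / exp (inverse t)) \<longlongrightarrow> 0) (at_right 0)"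
    by (rule filterlim_compose[OF _ filterlim_inverse_at_top_right])
  then show "((\<lambda>t. cutoff m t / t) \<longlongrightarrow> 0) (at_right 0)"
    by (rule Lim_transform_eventually)
      (auto simp: eventually_at_right_field cutoff_def exp_minus field_simps intro!: exI[of _ 1])
qed

lemma cutoff_has_real_derivative:
  "(cutoff m has_real_derivative (cutoff (m + 2) t - m * cutoff (Suc m) t)) (at t)"
proof (cases t "0::real" rule: linorder_cases)
  case less
  have "((\<lambda>_. 0) has_real_derivative 0) (at t)" by simp
  then have "(cutoff m has_real_derivative 0) (at t)"
    by (rule has_field_derivative_transform_within_open[of _ _ _ "{..<0}"]) (use less in \<open>auto simp: cutoff_def\<close>)
  then show ?thesis using less by (simp add: cutoff_def)
next
  case equal
  then show ?thesis using cutoff_div_tendsto_0[of m] by (simp add: DERIV_def cutoff_def)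
next
  case greater
  have "((\<lambda>t. exp (- inverse t) * inverse t ^ m) has_real_derivative
      (cutoff (m + 2) t - m * cutoff (Suc m) t)) (at t)"
    using greater
    \<comment> \<open>The power rule leaves the exponent \<open>m - Suc 0\<close>; the split on
      \<open>m\<close> removes the truncated subtraction.\<close>
    by (auto intro!: derivative_eq_intros simp: cutoff_def)
      (cases m; simp add: field_simps power2_eq_square)
  then show ?thesis
    by (rule has_field_derivative_transform_within_open[of _ _ _ "{0<..}"])
      (use greater in \<open>auto simp: cutoff_def\<close>)
qed

text \<open>Induction with \<open>m\<close> arbitrary: the chain rule yields
  \<open>cutoff (m + 2)\<close> and \<open>cutoff (Suc m)\<close> times an affine function. The
  parameter \<open>r\<close> acts as a squared radius.\<close>

lemma Ck_on_cutoff_sphere: "Ck_on k UNIV (\<lambda>x::'a::euclidean_space. cutoff m (r - (x - a) \<bullet> (x - a)))"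
proof (induction k arbitrary: m)
  case 0
  have "isCont (cutoff m) t" for t by (rule DERIV_isCont[OF cutoff_has_real_derivative])
  then have "continuous_on UNIV (cutoff m)" by (simp add: continuous_at_imp_continuous_on)
  then have "continuous_on UNIV (\<lambda>x. cutoff m (r - (x - a) \<bullet> (x - a)))"
    by (rule continuous_on_compose2) (auto intro!: continuous_intros)
  then show ?case by simp
next
  case (Suc k)
  let ?q = "\<lambda>x. r - (x - a) \<bullet> (x - a)"
  let ?d = "\<lambda>x. cutoff (m + 2) (?q x) - m * cutoff (Suc m) (?q x)"
  have der: "((\<lambda>x. cutoff m (?q x)) has_derivative (\<lambda>h. ?d x * (- 2 * ((x - a) \<bullet> h)))) (at x)" for x
  proof -
    have "(?q has_derivative (\<lambda>h. - 2 * ((x - a) \<bullet> h))) (at x)"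
      by (auto intro!: derivative_eq_intros simp: inner_commute)
    then show ?thesis
      using has_derivative_compose cutoff_has_real_derivative[THEN has_field_derivative_imp_has_derivative]
      by blast
  qed
  \<comment> \<open>Differences are rewritten as sums with negated factors, the form that the
    closure lemmas for \<open>Ck_on\<close> accept.\<close>
  have eq: "partial_deriv i (\<lambda>x. cutoff m (?q x))
      = (\<lambda>x. (cutoff (m + 2) (?q x) + (- m) * cutoff (Suc m) (?q x)) * (- 2 * (x \<bullet> i + - (a \<bullet> i))))" for i
    by (rule ext, subst partial_deriv_eq[OF der]) (simp add: algebra_simps)
  have "Ck_on k UNIV (partial_deriv i (\<lambda>x. cutoff m (?q x)))" for i
    unfolding eq by (intro Ck_on_UNIV_mult Ck_on_UNIV_add Ck_on_UNIV_const Ck_on_UNIV_inner Suc)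
  moreover have "(\<lambda>x. cutoff m (?q x)) differentiable (at x)" for x
    using der unfolding differentiable_def by blast
  ultimately show ?case by simp
qed

lemma test_function_exists:
  fixes a :: "'a::euclidean_space"
  assumes "r > 0" "cball a r \<subseteq> \<Omega>"
  obtains \<phi> where "test_function \<Omega> \<phi>" "\<And>x. \<phi> x \<ge> 0" "\<And>x. \<phi> x \<noteq> 0 \<longleftrightarrow> x \<in> ball a r"
proof
  let ?\<phi> = "\<lambda>x. cutoff 0 (r\<^sup>2 - (x - a) \<bullet> (x - a))"
  show nz: "?\<phi> x \<noteq> 0 \<longleftrightarrow> x \<in> ball a r" for x
  proof -
    have "(x - a) \<bullet> (x - a) < r\<^sup>2 \<longleftrightarrow> norm (x - a) < r"
      using \<open>r > 0\<close> by (simp add: norm_lt_square)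
    then show ?thesis by (auto simp: cutoff_def dist_norm norm_minus_commute)
  qed
  show "?\<phi> x \<ge> 0" for x by (simp add: cutoff_def)
  have "{x. ?\<phi> x \<noteq> 0} = ball a r" using nz by blast
  then have "closure {x. ?\<phi> x \<noteq> 0} = cball a r" using \<open>r > 0\<close> by simp
  then show "test_function \<Omega> ?\<phi>"
    unfolding test_function_def smooth_on_def using assms by (simp add: Ck_on_cutoff_sphere)
qed

text \<open>If \<open>g a\<close> were positive, a bump supported where \<open>g\<close> is positive
  would have a positive integral against \<open>g\<close>. The other sign follows by passing to
  \<open>- g\<close>.\<close>

lemma nonpos_if_orthogonal_test_functions:
  fixes \<Omega> :: "'a::euclidean_space set"
  assumes \<Omega>: "open \<Omega>" and g: "continuous_on \<Omega> g" and a: "a \<in> \<Omega>"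
    and orth: "\<And>\<phi>. test_function \<Omega> \<phi> \<Longrightarrow> (\<integral>x. g x * \<phi> x \<partial>lebesgue_on \<Omega>) = 0"
  shows "g a \<le> 0"
proof (rule ccontr)
  assume "\<not> g a \<le> 0"
  then have "open (\<Omega> \<inter> g -` {0<..})" "a \<in> \<Omega> \<inter> g -` {0<..}"
    using continuous_open_preimage[OF g \<Omega>, of "{0<..}"] a by auto
  then obtain r where r: "r > 0" "cball a r \<subseteq> \<Omega> \<inter> g -` {0<..}"
    using open_contains_cball_eq by metis
  then have "cball a r \<subseteq> \<Omega>" by blast
  from test_function_exists[OF \<open>r > 0\<close> this] obtain \<phi> where \<phi>: "test_function \<Omega> \<phi>"
    and nonneg: "\<And>x. \<phi> x \<ge> 0" and nz: "\<And>x. \<phi> x \<noteq> 0 \<longleftrightarrow> x \<in> ball a r" by blast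
  let ?h = "\<lambda>x. if x \<in> \<Omega> then g x * \<phi> x else 0"
  have h: "?h x \<ge> 0 \<and> (x \<in> ball a r \<longrightarrow> ?h x \<noteq> 0)" for x
  proof (cases "x \<in> ball a r")
    case True
    then have "x \<in> cball a r" by simp
    then have "x \<in> \<Omega>" "g x > 0" using r(2) by blast+
    then show ?thesis using nonneg[of x] nz[of x] by simp
  next
    case False
    then show ?thesis using nz[of x] by auto
  qed
  have "(\<integral>x. ?h x \<partial>lborel) = 0"
    using orth[OF \<phi>] test_function_integrable(2)[OF \<Omega> g \<phi>] by simp
  \<comment> \<open>A non-negative integrand of integral zero vanishes almost everywhere; as
    \<open>?h\<close> is nonzero on the whole ball, the ball would be a null set.\<close>
  then have "AE x in lborel. ?h x = 0"
    using integral_nonneg_eq_0_iff_AE[OF test_function_integrable(3)[OF \<Omega> g \<phi>]] h by simp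
  then have "AE x in lborel. x \<notin> ball a r"
    by (rule AE_mp) (intro AE_I2 impI notI, metis h)
  then have "ball a r \<in> null_sets lborel" by (subst AE_iff_null_sets) auto
  then have "negligible (ball a r)" by (simp add: negligible_iff_null_sets null_sets_completionI)
  then show False using open_not_negligible[OF open_ball, of a r] \<open>r > 0\<close> by simp
qed

lemma zero_if_orthogonal_test_functions:
  fixes \<Omega> :: "'a::euclidean_space set"
  assumes \<Omega>: "open \<Omega>" and g: "continuous_on \<Omega> g" and a: "a \<in> \<Omega>"
    and orth: "\<And>\<phi>. test_function \<Omega> \<phi> \<Longrightarrow> (\<integral>x. g x * \<phi> x \<partial>lebesgue_on \<Omega>) = 0"
  shows "g a = 0"
proof (rule antisym)
  show "g a \<le> 0" by (rule nonpos_if_orthogonal_test_functions[OF assms])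
  have "- g a \<le> 0"
    by (rule nonpos_if_orthogonal_test_functions[OF \<Omega> continuous_on_minus[OF g] a]) (simp add: orth)
  then show "0 \<le> g a" by simp
qed

section \<open>Second derivative test and Hopf's strong maximum principle\<close>

text \<open>If \<open>D\<close> were positive, \<open>g'\<close> would rise from
  \<open>g' 0 = 0\<close> to positive values just right of 0, and the mean value theorem would make
  \<open>g\<close> increase there.\<close>

lemma second_derivative_nonpos_at_max:
  fixes g g' :: "real \<Rightarrow> real"
  assumes \<rho>: "\<rho> > 0" and g: "\<And>t. \<bar>t\<bar> < \<rho> \<Longrightarrow> (g has_real_derivative g' t) (at t)"
    and D: "(g' has_real_derivative D) (at 0)" and max: "\<And>t. \<bar>t\<bar> < \<rho> \<Longrightarrow> g t \<le> g 0"
  shows "D \<le> 0"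
proof (rule ccontr)
  assume "\<not> D \<le> 0"
  have "g' 0 = 0"
    by (rule DERIV_local_max[OF g[of 0] \<rho>]) (use \<rho> max in auto)
  obtain d where d: "d > 0" "\<And>h. 0 < h \<Longrightarrow> h < d \<Longrightarrow> g' 0 < g' (0 + h)"
    using DERIV_pos_inc_right[OF D] \<open>\<not> D \<le> 0\<close> by force
  define t where "t = min d \<rho> / 2"
  have t: "0 < t" "t < d" "t < \<rho>" using d \<rho> by (auto simp: t_def)
  have "\<exists>z. 0 < z \<and> z < t \<and> g t - g 0 = (t - 0) * g' z"
    by (rule MVT2) (use t in \<open>auto intro!: g\<close>)
  then obtain z where z: "0 < z" "z < t" "g t - g 0 = t * g' z" by auto
  have "g' z > 0" using d(2)[of z] z t \<open>g' 0 = 0\<close> by simp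
  then have "g t > g 0" using z(3) t(1) mult_pos_pos[of t "g' z"] by linarith
  then show False using max[of t] t by simp
qed

text \<open>The second derivative test on each coordinate line through \<open>p\<close>, summed over
  the basis. The factor of \<open>\<delta>\<close> in the conclusion is the Laplacian of
  \<open>w A B \<nu> z\<close>.\<close>

lemma laplacian_at_max_plus_quadratic:
  fixes f :: "'a::euclidean_space \<Rightarrow> real"
  defines "w \<equiv> \<lambda>A B \<nu> z x. \<nu> \<bullet> (x - z) + A * (\<nu> \<bullet> (x - z))\<^sup>2 - B * ((x - z) \<bullet> (x - z))"
  assumes \<rho>: "\<rho> > 0" and f: "\<And>x. x \<in> ball p \<rho> \<Longrightarrow> f differentiable (at x)"
    and f1: "\<And>i. i \<in> Basis \<Longrightarrow> partial_deriv i f differentiable (at p)"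
    and max: "\<And>x. x \<in> ball p \<rho> \<Longrightarrow> f x + \<delta> * w A B \<nu> z x \<le> f p + \<delta> * w A B \<nu> z p"
  shows "laplacian f p + \<delta> * (2 * A * (\<nu> \<bullet> \<nu>) - 2 * B * DIM('a)) \<le> 0"
proof -
  have *: "partial_deriv i (partial_deriv i f) p + \<delta> * (2 * A * (\<nu> \<bullet> i)\<^sup>2 - 2 * B) \<le> 0"
    if i: "i \<in> Basis" for i
  proof -
    \<comment> \<open>With these constants \<open>w\<close> on the line is an explicit quadratic
      polynomial in \<open>t\<close>.\<close>
    define s n P Q where "s = \<nu> \<bullet> (p - z)" and "n = \<nu> \<bullet> i" and "P = (p - z) \<bullet> (p - z)" and "Q = (p - z) \<bullet> i"
    have w_line: "w A B \<nu> z (p + t *\<^sub>R i) = (s + t * n) + A * (s + t * n)\<^sup>2 - B * (P + 2 * t * Q + t\<^sup>2)" for t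
    proof -
      have "p + t *\<^sub>R i - z = (p - z) + t *\<^sub>R i" by simp
      then show ?thesis
        using i by (simp add: w_def s_def n_def P_def Q_def inner_add_left inner_add_right
            inner_commute power2_eq_square algebra_simps del: diff_add_eq)
    qed
    define g where "g t = f (p + t *\<^sub>R i) + \<delta> * ((s + t * n) + A * (s + t * n)\<^sup>2 - B * (P + 2 * t * Q + t\<^sup>2))" for t
    define g' where "g' t = partial_deriv i f (p + t *\<^sub>R i) + \<delta> * (n + 2 * A * (s + t * n) * n - B * (2 * Q + 2 * t))" for t
    have in_ball: "p + t *\<^sub>R i \<in> ball p \<rho>" if "\<bar>t\<bar> < \<rho>" for t
      using that i by (simp add: dist_norm)
    show ?thesis
    proof (rule second_derivative_nonpos_at_max[OF \<rho>])
      show "(g has_real_derivative g' t) (at t)" if "\<bar>t\<bar> < \<rho>" for t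
      proof -
        have "((\<lambda>t. \<delta> * ((s + t * n) + A * (s + t * n)\<^sup>2 - B * (P + 2 * t * Q + t\<^sup>2))) has_real_derivative
            \<delta> * (n + 2 * A * (s + t * n) * n - B * (2 * Q + 2 * t))) (at t)"
          by (auto intro!: derivative_eq_intros)
        from DERIV_add[OF has_real_derivative_line[OF f[OF in_ball[OF that]]] this]
        show ?thesis by (simp add: g_def[abs_def] g'_def)
      qed
      have "((\<lambda>t. \<delta> * (n + 2 * A * (s + t * n) * n - B * (2 * Q + 2 * t))) has_real_derivative
          \<delta> * (2 * A * n\<^sup>2 - 2 * B)) (at 0)"
        by (auto intro!: derivative_eq_intros simp: power2_eq_square)
      moreover have "((\<lambda>t. partial_deriv i f (p + t *\<^sub>R i)) has_real_derivative
          partial_deriv i (partial_deriv i f) p) (at 0)"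
        using has_real_derivative_line[of "partial_deriv i f" p 0 i] f1[OF i] by simp
      ultimately show "(g' has_real_derivative (partial_deriv i (partial_deriv i f) p + \<delta> * (2 * A * (\<nu> \<bullet> i)\<^sup>2 - 2 * B))) (at 0)"
        unfolding g'_def[abs_def] n_def[symmetric] by (intro DERIV_add)
      show "g t \<le> g 0" if "\<bar>t\<bar> < \<rho>" for t
        using max[OF in_ball[OF that]] w_line[of t] w_line[of 0] by (simp add: g_def)
    qed
  qed
  have "(\<Sum>i\<in>Basis. partial_deriv i (partial_deriv i f) p + \<delta> * (2 * A * (\<nu> \<bullet> i)\<^sup>2 - 2 * B)) \<le> 0"
    by (intro sum_nonpos *)
  also have "(\<Sum>i\<in>Basis. partial_deriv i (partial_deriv i f) p + \<delta> * (2 * A * (\<nu> \<bullet> i)\<^sup>2 - 2 * B))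
      = laplacian f p + \<delta> * (2 * A * (\<nu> \<bullet> \<nu>) - 2 * B * DIM('a))"
    unfolding euclidean_inner[of \<nu> \<nu>] laplacian_def
    by (simp add: sum.distrib sum_subtractf sum_distrib_left power2_eq_square algebra_simps)
  finally show ?thesis .
qed

text \<open>The barrier \<open>w\<close> vanishes at the touching point \<open>z\<close> and is negative on small spheres around
  \<open>z\<close> outside the touching ball, so \<open>f + \<delta> * w\<close> has an interior maximum.\<close>

lemma no_touching_ball:
  fixes f :: "'a::euclidean_space \<Rightarrow> real"
  assumes \<Omega>: "open \<Omega>" and \<epsilon>: "\<epsilon> > 0" and f: "\<And>x. x \<in> \<Omega> \<Longrightarrow> f differentiable (at x)"
    and f1: "\<And>i x. i \<in> Basis \<Longrightarrow> x \<in> \<Omega> \<Longrightarrow> partial_deriv i f differentiable (at x)"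
    and pde: "\<And>x. x \<in> \<Omega> \<Longrightarrow> laplacian f x = \<epsilon> * f x"
    and nonpos: "\<And>x. x \<in> \<Omega> \<Longrightarrow> f x \<le> 0"
    and z: "z \<in> \<Omega>" "f z = 0" and R: "R > 0" "dist y z = R"
    and neg: "\<And>x. x \<in> ball y R \<Longrightarrow> f x < 0"
  shows False
proof -
  \<comment> \<open>\<open>\<nu>\<close> points from \<open>z\<close> to the centre of the ball.
    \<open>B\<close> is such that \<open>w \<ge> 0\<close> on the small sphere forces a point inside
    the touching ball, and \<open>A\<close> such that \<open>w\<close> has Laplacian
    \<open>2 * \<epsilon> + 2\<close>.\<close>
  define \<nu> where "\<nu> = (y - z) /\<^sub>R R"
  define B where "B = 2 / R"
  define A where "A = B * DIM('a) + \<epsilon> + 1"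
  have \<nu>: "norm \<nu> = 1" using R by (simp add: \<nu>_def dist_norm)
  have "B > 0" using R by (simp add: B_def)
  then have "A > 0" using \<epsilon> by (simp add: A_def add_pos_pos)
  obtain r1 where r1: "r1 > 0" "cball z r1 \<subseteq> \<Omega>" using open_contains_cball_eq[OF \<Omega>] z(1) by blast
  \<comment> \<open>With \<open>s = \<nu> \<bullet> (x - z)\<close>, the bound
    \<open>r \<le> 1 / A\<close> gives \<open>A * s^2 \<le> r\<close>, and \<open>r \<le> 1\<close>
    then bounds \<open>w\<close> by 2.\<close>
  define r where "r = min r1 (min 1 (1 / A))"
  have r: "r > 0" "r \<le> 1" "r \<le> 1 / A" "cball z r \<subseteq> \<Omega>"
    using r1 \<open>A > 0\<close> by (auto simp: r_def)
  have Ar: "A * r \<le> 1" using r(3) \<open>A > 0\<close> by (simp add: field_simps)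
  define w where "w x = \<nu> \<bullet> (x - z) + A * (\<nu> \<bullet> (x - z))\<^sup>2 - B * ((x - z) \<bullet> (x - z))" for x
  have wz: "w z = 0" by (simp add: w_def)
  have contw: "continuous_on S w" for S unfolding w_def[abs_def] by (intro continuous_intros)
  have contf: "continuous_on (cball z r) f"
    using f r(4) by (meson continuous_at_imp_continuous_on differentiable_imp_continuous_within subsetD)
  have s_le: "\<bar>\<nu> \<bullet> (x - z)\<bar> \<le> r" if "x \<in> cball z r" for x
    using Cauchy_Schwarz_ineq2[of \<nu> "x - z"] that \<nu> by (simp add: dist_norm norm_minus_commute)
  have w_le: "w x \<le> 2" if "x \<in> cball z r" for x
  proof -
    define s where "s = \<nu> \<bullet> (x - z)"
    have s: "\<bar>s\<bar> \<le> r" using s_le[OF that] by (simp add: s_def)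
    then have "s\<^sup>2 \<le> r\<^sup>2" using abs_le_square_iff[of s r] r(1) by simp
    then have "A * s\<^sup>2 \<le> A * r * r" using \<open>A > 0\<close> by (simp add: power2_eq_square)
    also have "\<dots> \<le> 1 * r" using Ar r(1) by (intro mult_right_mono) auto
    finally have "A * s\<^sup>2 \<le> r" by simp
    moreover have "B * ((x - z) \<bullet> (x - z)) \<ge> 0" using \<open>B > 0\<close> by simp
    ultimately show ?thesis using s r(2) unfolding w_def s_def[symmetric] by linarith
  qed
  have w_nonneg: "f x < 0" if x: "x \<in> sphere z r" "w x \<ge> 0" for x
  proof -
    define s where "s = \<nu> \<bullet> (x - z)"
    have "(x - z) \<bullet> (x - z) = r\<^sup>2"
      using x(1) by (simp add: dist_norm norm_minus_commute flip: power2_norm_eq_inner)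
    then have w: "w x = s * (1 + A * s) - B * r\<^sup>2" by (simp add: w_def s_def power2_eq_square algebra_simps)
    have s: "\<bar>s\<bar> \<le> r" using s_le[of x] x(1) by (simp add: s_def)
    then have "A * \<bar>s\<bar> \<le> A * r" using \<open>A > 0\<close> by simp
    then have As: "\<bar>A * s\<bar> \<le> 1" using Ar \<open>A > 0\<close> by (metis abs_mult abs_of_pos order_trans)
    have "B * r\<^sup>2 > 0" using \<open>B > 0\<close> r(1) by simp
    have "s > 0"
    proof (rule ccontr)
      assume "\<not> s > 0"
      then have "s * (1 + A * s) \<le> 0" using As by (intro mult_nonpos_nonneg) auto
      then show False using w x(2) \<open>B * r\<^sup>2 > 0\<close> by linarith
    qed
    then have "s * (1 + A * s) \<le> s * 2" using As by (intro mult_left_mono) auto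
    then have "B * r\<^sup>2 \<le> s * 2" using w x(2) by linarith
    then have "r\<^sup>2 \<le> R * s" using R(1) by (simp add: B_def field_simps)
    \<comment> \<open>Law of cosines with \<open>y - z = R *\<^sub>R \<nu>\<close>; together with
      \<open>r\<^sup>2 \<le> R * s\<close> it leaves at most
      \<open>R\<^sup>2 - r\<^sup>2\<close>.\<close>
    have "(dist y x)\<^sup>2 = ((x - z) - R *\<^sub>R \<nu>) \<bullet> ((x - z) - R *\<^sub>R \<nu>)"
      using R(1) by (simp add: \<nu>_def dist_norm norm_minus_commute power2_norm_eq_inner)
    also have "\<dots> = r\<^sup>2 - 2 * R * s + R\<^sup>2"
      using \<open>(x - z) \<bullet> (x - z) = r\<^sup>2\<close> \<nu>
      by (simp add: inner_diff_left inner_diff_right inner_commute s_def norm_eq_1 power2_eq_square algebra_simps)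
    also have "\<dots> < R\<^sup>2" using \<open>r\<^sup>2 \<le> R * s\<close> zero_less_power[OF r(1), of 2] by linarith
    finally have "dist y x < R" using R(1) by (simp add: power_less_imp_less_base)
    then show ?thesis by (intro neg) simp
  qed
  have "\<exists>\<delta>>0. \<forall>x\<in>sphere z r. f x + \<delta> * w x < 0"
  proof -
    define S where "S = sphere z r \<inter> w -` {0..}"
    have "closed S" unfolding S_def by (intro continuous_closed_preimage contw) auto
    then have "compact S" unfolding S_def by (metis compact_Int_closed compact_sphere inf.left_idem)
    have le0: "f x \<le> 0" if "x \<in> sphere z r" for x using nonpos[of x] r(4) that by auto
    obtain \<delta> where \<delta>: "\<delta> > 0" "\<And>x. x \<in> S \<Longrightarrow> f x + \<delta> * w x < 0"
    proof (cases "S = {}")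
      case True
      then show ?thesis using that[of 1] by simp
    next
      case False
      have "continuous_on S f" by (rule continuous_on_subset[OF contf]) (auto simp: S_def)
      then obtain q where q: "q \<in> S" "\<And>x. x \<in> S \<Longrightarrow> f x \<le> f q"
        using continuous_attains_sup[OF \<open>compact S\<close> False] by blast
      have "f q < 0" using w_nonneg[of q] q(1) by (auto simp: S_def)
      show ?thesis
      \<comment> \<open>As \<open>w \<le> 2\<close>, the perturbation is at most two thirds of
        \<open>- f q\<close>, so the sum is at most \<open>f q / 3\<close>.\<close>
      proof (rule that[of "- f q / 3"])
        show "f x + - f q / 3 * w x < 0" if "x \<in> S" for x
        proof -
          have "- f q / 3 * w x \<le> - f q / 3 * 2"
            using w_le[of x] that \<open>f q < 0\<close> by (intro mult_left_mono) (auto simp: S_def)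
          then show ?thesis using q(2)[OF that] \<open>f q < 0\<close> by linarith
        qed
      qed (use \<open>f q < 0\<close> in simp)
    qed
    have "f x + \<delta> * w x < 0" if x: "x \<in> sphere z r" for x
    proof (cases "x \<in> S")
      case False
      then have "w x < 0" using x by (auto simp: S_def)
      then have "\<delta> * w x < 0" using \<delta>(1) by (simp add: mult_pos_neg)
      then show ?thesis using le0[OF x] by simp
    qed (use \<delta>(2) in blast)
    then show ?thesis using \<delta>(1) by blast
  qed
  then obtain \<delta> where \<delta>: "\<delta> > 0" "\<And>x. x \<in> sphere z r \<Longrightarrow> f x + \<delta> * w x < 0" by blast
  have "continuous_on (cball z r) (\<lambda>x. f x + \<delta> * w x)" by (intro continuous_intros contf contw)
  then obtain p where p: "p \<in> cball z r" "\<And>x. x \<in> cball z r \<Longrightarrow> f x + \<delta> * w x \<le> f p + \<delta> * w p"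
    using continuous_attains_sup[OF compact_cball, of z r] r(1) by fastforce
  have p0: "f p + \<delta> * w p \<ge> 0" using p(2)[of z] r(1) z(2) wz by simp
  then have "p \<in> ball z r" using p(1) \<delta>(2)[of p] by (auto simp: less_le)
  then obtain \<rho> where \<rho>: "\<rho> > 0" "ball p \<rho> \<subseteq> ball z r" using open_contains_ball_eq[OF open_ball] by blast
  have "p \<in> \<Omega>" using p(1) r(4) by blast
  have "ball p \<rho> \<subseteq> cball z r" using \<rho>(2) ball_subset_cball by blast
  then have "laplacian f p + \<delta> * (2 * A * (\<nu> \<bullet> \<nu>) - 2 * B * DIM('a)) \<le> 0"
    using f f1[OF _ \<open>p \<in> \<Omega>\<close>] p(2) r(4) unfolding w_def
    by (intro laplacian_at_max_plus_quadratic[OF \<rho>(1)]) blast+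
  moreover have "\<nu> \<bullet> \<nu> = 1" using \<nu> by (simp add: norm_eq_1)
  \<comment> \<open>Since \<open>w \<le> 2\<close> forces \<open>f p \<ge> - 2 * \<delta>\<close>,
    the left side is at least \<open>2 * \<delta>\<close>; the summand \<open>\<epsilon> + 1\<close>
    in \<open>A\<close> provides this margin.\<close>
  ultimately have "\<epsilon> * f p + \<delta> * (2 * \<epsilon> + 2) \<le> 0"
    using pde[OF \<open>p \<in> \<Omega>\<close>] by (simp add: A_def algebra_simps)
  moreover have "f p \<ge> - (\<delta> * 2)"
    using p0 mult_left_mono[OF w_le[OF p(1)], of \<delta>] \<delta>(1) by linarith
  then have "\<epsilon> * f p \<ge> \<epsilon> * - (\<delta> * 2)" using \<epsilon> by (intro mult_left_mono) auto
  ultimately show False using \<delta>(1) by (simp add: algebra_simps)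
qed

text \<open>Once the maximum is known to be 0, the zero set is open by
  \<open>no_touching_ball\<close> and the set where \<open>f\<close> is negative is open by
  continuity; connectedness leaves only the former.\<close>

lemma strong_maximum_principle:
  fixes f :: "'a::euclidean_space \<Rightarrow> real"
  assumes \<Omega>: "open \<Omega>" "connected \<Omega>" and \<epsilon>: "\<epsilon> > 0"
    and f: "\<And>x. x \<in> \<Omega> \<Longrightarrow> f differentiable (at x)"
    and f1: "\<And>i x. i \<in> Basis \<Longrightarrow> x \<in> \<Omega> \<Longrightarrow> partial_deriv i f differentiable (at x)"
    and pde: "\<And>x. x \<in> \<Omega> \<Longrightarrow> laplacian f x = \<epsilon> * f x"
    and x0: "x0 \<in> \<Omega>" "f x0 \<ge> 0" and max: "\<And>x. x \<in> \<Omega> \<Longrightarrow> f x \<le> f x0"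
    and x: "x \<in> \<Omega>"
  shows "f x = 0"
proof -
  have contf: "continuous_on \<Omega> f"
    using f by (simp add: continuous_at_imp_continuous_on differentiable_imp_continuous_within)
  obtain \<rho> where \<rho>: "\<rho> > 0" "ball x0 \<rho> \<subseteq> \<Omega>" using open_contains_ball_eq[OF \<Omega>(1)] x0(1) by blast
  \<comment> \<open>With \<open>\<delta> = 0\<close> the barrier disappears and the plain second
    derivative test for \<open>f\<close> remains.\<close>
  have "laplacian f x0 + 0 * (2 * 0 * ((0::'a) \<bullet> 0) - 2 * (0::real) * DIM('a)) \<le> 0"
    by (rule laplacian_at_max_plus_quadratic[OF \<rho>(1), of x0 f 0 0 0 0 0]) (use f f1 \<rho>(2) x0(1) max in auto)
  then have "\<epsilon> * f x0 \<le> 0" using pde[OF x0(1)] by simp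
  then have f0: "f x0 = 0" using \<epsilon> x0(2) by (simp add: mult_le_0_iff)
  have nonpos: "f x \<le> 0" if "x \<in> \<Omega>" for x using max[OF that] f0 by simp
  define U where "U = \<Omega> \<inter> f -` {..<0}"
  define S where "S = \<Omega> \<inter> f -` {0}"
  have "open U" unfolding U_def by (rule continuous_open_preimage[OF contf \<Omega>(1)]) simp
  have split: "U \<union> S = \<Omega>" "U \<inter> S = {}" using nonpos by (auto simp: U_def S_def less_le)
  have "open S"
  proof (rule ccontr)
    assume "\<not> open S"
    then obtain z0 where z0: "z0 \<in> S" "\<And>e. e > 0 \<Longrightarrow> \<not> ball z0 e \<subseteq> S"
      unfolding open_contains_ball by blast
    then have "z0 \<in> \<Omega>" "f z0 = 0" by (auto simp: S_def)
    then obtain r where r: "r > 0" "cball z0 r \<subseteq> \<Omega>" using open_contains_cball_eq[OF \<Omega>(1)] by blast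
    \<comment> \<open>Half the radius, because the nearest zero to \<open>y\<close> is no farther
      than \<open>z0\<close>, and the ball around \<open>y\<close> reaching it must stay in
      \<open>cball z0 r\<close>.\<close>
    obtain y where y: "y \<in> ball z0 (r / 2)" "y \<notin> S" using z0(2)[of "r / 2"] r(1) by (meson half_gt_zero subsetI)
    \<comment> \<open>The zero set is closed only relative to \<open>\<Omega>\<close>; intersected
      with a closed ball inside \<open>\<Omega>\<close> it is closed, so a nearest zero
      exists.\<close>
    define T where "T = cball z0 r \<inter> f -` {0}"
    have "closed T" unfolding T_def
      by (intro continuous_closed_preimage continuous_on_subset[OF contf r(2)]) auto
    have "z0 \<in> T" using \<open>f z0 = 0\<close> r(1) by (simp add: T_def)
    then obtain z where z: "z \<in> T" "\<And>t. t \<in> T \<Longrightarrow> dist y z \<le> dist y t"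
      using distance_attains_inf[OF \<open>closed T\<close>, of y] by blast
    have "y \<in> \<Omega>" using y(1) r by auto
    show False
    proof (rule no_touching_ball[OF \<Omega>(1) \<epsilon> f f1 pde nonpos])
      show "z \<in> \<Omega>" "f z = 0" using z(1) r(2) by (auto simp: T_def)
      show "dist y z > 0" using y(2) \<open>y \<in> \<Omega>\<close> \<open>f z = 0\<close> by (auto simp: S_def)
      show "f x < 0" if "x \<in> ball y (dist y z)" for x
      proof -
        have "dist y z \<le> dist y z0" by (rule z(2)[OF \<open>z0 \<in> T\<close>])
        moreover have "dist z0 x \<le> dist z0 y + dist y x" by (rule dist_triangle)
        ultimately have "x \<in> cball z0 r" using that y(1) by (simp add: dist_commute)
        moreover have "x \<notin> T" using z(2)[of x] that by auto
        ultimately show ?thesis using nonpos[of x] r(2) by (auto simp: T_def less_le)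
      qed
    qed auto
  qed
  then have "U = {}"
    using connectedD[OF \<Omega>(2) \<open>open U\<close>, of S] split x0(1) f0 by (auto simp: S_def)
  then show ?thesis using split x by (auto simp: S_def)
qed

theorem mainTheorem3:
  fixes \<Omega> :: "'a::euclidean_space set"
    and \<epsilon> :: real
    and d :: "'a \<Rightarrow> real"
    and f u :: "real \<Rightarrow> 'a \<Rightarrow> real"
    and fstar :: "'a \<Rightarrow> real"
  assumes "bounded_pw_smooth_domain \<Omega>"
    and "\<epsilon> > 0"
    and "d \<in> L2 (surface_measure \<Omega>)"
    and "\<And>\<alpha>. \<alpha> > 0 \<Longrightarrow> tikhonov_solution \<Omega> \<epsilon> d \<alpha> (f \<alpha>) (u \<alpha>)"
    and "L2_tendsto (lebesgue_on \<Omega>) f fstar (at_right 0)"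
    and "moore_penrose_solution \<Omega> \<epsilon> d fstar"
    and "Ck_closure 2 \<Omega> fstar"
  shows "(\<forall>x\<in>\<Omega>. - laplacian fstar x + \<epsilon> * fstar x = 0) \<and>
         ((\<exists>x\<in>\<Omega>. fstar x \<noteq> 0) \<longrightarrow>
            \<not> (\<exists>x0\<in>\<Omega>. fstar x0 \<ge> 0 \<and> (\<forall>x\<in>closure \<Omega>. fstar x \<le> fstar x0)))"
proof -
  have \<Omega>: "open \<Omega>" "connected \<Omega>" using assms(1) by (auto simp: bounded_pw_smooth_domain_def)
  have C2: "Ck_extends (Suc (Suc 0)) \<Omega> fstar" using assms(7) by (simp add: Ck_closure_def numeral_2_eq_2)
  have f: "fstar differentiable (at x)" if "x \<in> \<Omega>" for x using C2 that by simp
  have f1: "partial_deriv i fstar differentiable (at x)" if "i \<in> Basis" "x \<in> \<Omega>" for i x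
    using C2 that by simp
  have f2: "continuous_on \<Omega> (partial_deriv i (partial_deriv i fstar))" if "i \<in> Basis" for i
  proof -
    \<comment> \<open>At order 0 only a continuous extension \<open>g\<close> to the closure is
      given; continuity in \<open>\<Omega>\<close> is read off from it.\<close>
    have "Ck_extends 0 \<Omega> (partial_deriv i (partial_deriv i fstar))" using C2 that by simp
    then obtain g where g: "continuous_on (closure \<Omega>) g"
      "\<And>x. x \<in> \<Omega> \<Longrightarrow> g x = partial_deriv i (partial_deriv i fstar) x" by auto
    have "continuous_on \<Omega> g" using continuous_on_subset[OF g(1) closure_subset] .
    then show ?thesis using g(2) continuous_on_cong[OF refl, of \<Omega>] by metis
  qed
  have contf: "continuous_on \<Omega> fstar"
    using f by (simp add: continuous_at_imp_continuous_on differentiable_imp_continuous_within)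
  have "continuous_on \<Omega> (\<lambda>x. - laplacian fstar x + \<epsilon> * fstar x)"
    unfolding laplacian_def by (intro continuous_intros f2 contf)
  then have pde: "- laplacian fstar x + \<epsilon> * fstar x = 0" if "x \<in> \<Omega>" for x
    by (rule zero_if_orthogonal_test_functions[OF \<Omega>(1) _ that])
      (rule integral_helmholtz_eq_0[OF \<Omega>(1) f contf f1 f2 assms(6)])
  \<comment> \<open>A non-negative interior maximum forces the zero function, which does attain such
    a maximum; hence the premise of the second claim that \<open>fstar\<close> is nonzero
    somewhere.\<close>
  moreover have "fstar x = 0"
    if "x0 \<in> \<Omega>" "fstar x0 \<ge> 0" "\<forall>x\<in>closure \<Omega>. fstar x \<le> fstar x0" "x \<in> \<Omega>" for x0 x
  proof (rule strong_maximum_principle[OF \<Omega> assms(2) f f1 _ that(1,2) _ that(4)])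
    show "laplacian fstar y = \<epsilon> * fstar y" if "y \<in> \<Omega>" for y using pde[OF that] by simp
    show "fstar y \<le> fstar x0" if "y \<in> \<Omega>" for y
      using \<open>\<forall>x\<in>closure \<Omega>. _\<close> that closure_subset by blast
  qed
  ultimately show ?thesis by blast
qed

end
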